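(* Let $\mathcal{A}$ be the abelian category of all small $R$-modules, where $R=\mathbb{Z}[I]$ is the polynomial ring freely generated by the class $I$ of all small ordinals. Let $\mathbf{K}(\mathcal{A})$ be the homotopy category of chain complexes in $\mathcal{A}$ and let $\mathbf{A}(\mathcal{A})\subset\mathbf{K}(\mathcal{A})$ be the full subcategory of acyclic complexes. Then there is neither a Bousfield localization nor a Bousfield colocalization for $\mathbf{A}(\mathcal{A})$ in $\mathbf{K}(\mathcal{A})$. Moreover, the inclusion functor $i\colon\mathbf{A}(\mathcal{A})\to\mathbf{K}(\mathcal{A})$ has neither a right adjoint nor a left adjoint.
   Context: Foundations are those of Mac Lane (Categories for the Working Mathematician, I.6): a universe $U$ is fixed, a set is small if it is an element of $U$, and classes are subsets of $U$. Let $I$ be the class of all small ordinals and let $R=\mathbb{Z}[I]$ be the (commutative) polynomial ring over $\mathbb{Z}$ freely generated by $I$. The category $\mathcal{A}$ is the abelian category of all small $R$-modules: an object is a small abelian group $M$ together with group endomorphisms $\varphi_i\colon M\to M$ for every $i\in I$, such that all the $\varphi_i$ commute with one another; morphisms are the $R$-module homomorphisms, i.e. the group homomorphisms commuting with all $\varphi_i$. $\mathbf{K}(\mathcal{A})$ has as objects the (unbounded) chain complexes in $\mathcal{A}$ and as morphisms the chain homotopy classes of chain maps. Both $\mathbf{K}(\mathcal{A})$ and $\mathbf{A}(\mathcal{A})$ are triangulated categories with small $\operatorname{Hom}$-sets; $\mathbf{K}(\mathcal{A})$ has small products and coproducts, and the triangulated subcategory $\mathbf{A}(\mathcal{A})$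 is closed under both coproducts and products (it is localizing and colocalizing). The derived category is the Verdier quotient $\mathbf{D}(\mathcal{A})=\mathbf{K}(\mathcal{A})/\mathbf{A}(\mathcal{A})$. A Bousfield localization for the pair $\mathbf{A}(\mathcal{A})\subset\mathbf{K}(\mathcal{A})$ is a right adjoint of the canonical functor $\mathbf{K}(\mathcal{A})\to\mathbf{D}(\mathcal{A})$, and a Bousfield colocalization is a left adjoint of this functor. *)

theory Defs
  imports
    "HOL-Algebra.Module"
    "HOL-Library.FuncSet"
    "HOL-Library.Poly_Mapping"
begin

section \<open>Grothendieck universes\<close>

text \<open>
  The universe is the type \<open>'u\<close>, and \<open>elts a\<close> is the set of members of \<open>a\<close>. So the sets of the
  universe are the elements of \<open>'u\<close>, and its classes are the elements of \<open>'u set\<close>.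
\<close>

text \<open>Von Neumann ordinals. The membership relation is well-founded in a universe, so it well-orders
  \<open>elts a\<close> as soon as it is total on it.\<close>

definition ordinal :: "('u \<Rightarrow> 'u set) \<Rightarrow> 'u \<Rightarrow> bool" where
  "ordinal elts a \<longleftrightarrow>
     (\<forall>x\<in>elts a. elts x \<subseteq> elts a) \<and>
     (\<forall>x\<in>elts a. \<forall>y\<in>elts a. x \<in> elts y \<or> x = y \<or> y \<in> elts x)"

text \<open>
  The closure conditions are those of Mac Lane, I.6; extensionality and foundation are inherited
  from the surrounding set theory. Transitivity of the universe is built into the typing, the set
  in \<open>infinity\<close> is the first infinite ordinal, and closure under ordered pairs and cartesian
  products follows from the other conditions.
\<close>

locale universe =
  fixes elts :: "'u \<Rightarrow> 'u set"
  assumes extensionality: "elts a = elts b \<Longrightarrow> a = b"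
    and foundation: "wf {(x, y). x \<in> elts y}"
    and pairing: "\<exists>c. elts c = {a, b}"
    and union: "\<exists>c. elts c = (\<Union>x\<in>elts a. elts x)"
    and power: "\<exists>c. elts c = {x. elts x \<subseteq> elts a}"
    and infinity: "\<exists>c. elts c = {n. ordinal elts n \<and> finite (elts n)}"
    and replacement: "\<exists>c. elts c = f ` elts a"


section \<open>Categories, functors and adjoints\<close>

text \<open>Hom-sets need not be disjoint; identities and composition therefore carry the objects as
  arguments: \<open>cmp C X Y Z g f\<close> is the composite of \<open>f : X \<rightarrow> Y\<close> and \<open>g : Y \<rightarrow> Z\<close>.\<close>

record ('o, 'm) category =
  obj :: "'o set"
  homs :: "'o \<Rightarrow> 'o \<Rightarrow> 'm set"
  ide :: "'o \<Rightarrow> 'm"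
  cmp :: "'o \<Rightarrow> 'o \<Rightarrow> 'o \<Rightarrow> 'm \<Rightarrow> 'm \<Rightarrow> 'm"

record ('o, 'm, 'p, 'n) functor_data =
  on_obj :: "'o \<Rightarrow> 'p"
  on_hom :: "'o \<Rightarrow> 'o \<Rightarrow> 'm \<Rightarrow> 'n"

definition is_functor ::
  "('o, 'm) category \<Rightarrow> ('p, 'n) category \<Rightarrow> ('o, 'm, 'p, 'n) functor_data \<Rightarrow> bool" where
  "is_functor C D F \<longleftrightarrow>
     (\<forall>X\<in>obj C. on_obj F X \<in> obj D) \<and>
     (\<forall>X\<in>obj C. \<forall>Y\<in>obj C. \<forall>f\<in>homs C X Y.
        on_hom F X Y f \<in> homs D (on_obj F X) (on_obj F Y)) \<and>
     (\<forall>X\<in>obj C. on_hom F X X (ide C X) = ide D (on_obj F X)) \<and>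
     (\<forall>X\<in>obj C. \<forall>Y\<in>obj C. \<forall>Z\<in>obj C. \<forall>f\<in>homs C X Y. \<forall>g\<in>homs C Y Z.
        on_hom F X Z (cmp C X Y Z g f) =
        cmp D (on_obj F X) (on_obj F Y) (on_obj F Z) (on_hom F Y Z g) (on_hom F X Y f))"

text \<open>\<open>\<phi>\<close> is a bijection \<open>D(F X, Y) \<cong> C(X, G Y)\<close>, natural in \<open>X\<close> and \<open>Y\<close>, exhibiting \<open>F : C \<rightarrow> D\<close> as
  left adjoint to \<open>G : D \<rightarrow> C\<close>. Functoriality of \<open>F\<close> and \<open>G\<close> is not part of this predicate.\<close>

definition adjunction ::
  "('o, 'm) category \<Rightarrow> ('p, 'n) category \<Rightarrow> ('o, 'm, 'p, 'n) functor_data \<Rightarrow> ('p, 'n, 'o, 'm) functor_data \<Rightarrow>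
   ('o \<Rightarrow> 'p \<Rightarrow> 'n \<Rightarrow> 'm) \<Rightarrow> bool" where
  "adjunction C D F G \<phi> \<longleftrightarrow>
     (\<forall>X\<in>obj C. \<forall>Y\<in>obj D.
        bij_betw (\<phi> X Y) (homs D (on_obj F X) Y) (homs C X (on_obj G Y))) \<and>
     (\<forall>X\<in>obj C. \<forall>X'\<in>obj C. \<forall>Y\<in>obj D. \<forall>Y'\<in>obj D.
        \<forall>h\<in>homs C X' X. \<forall>k\<in>homs D Y Y'. \<forall>a\<in>homs D (on_obj F X) Y.
        \<phi> X' Y' (cmp D (on_obj F X') (on_obj F X) Y'
                   (cmp D (on_obj F X) Y Y' k a) (on_hom F X' X h)) =
        cmp C X' X (on_obj G Y')
          (cmp C X (on_obj G Y) (on_obj G Y') (on_hom G Y Y' k) (\<phi> X Y a)) h)"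

definition has_right_adjoint ::
  "('o, 'm) category \<Rightarrow> ('p, 'n) category \<Rightarrow> ('o, 'm, 'p, 'n) functor_data \<Rightarrow> bool" where
  "has_right_adjoint C D F \<longleftrightarrow> (\<exists>G \<phi>. is_functor D C G \<and> adjunction C D F G \<phi>)"

definition has_left_adjoint ::
  "('o, 'm) category \<Rightarrow> ('p, 'n) category \<Rightarrow> ('o, 'm, 'p, 'n) functor_data \<Rightarrow> bool" where
  "has_left_adjoint C D F \<longleftrightarrow> (\<exists>G \<phi>. is_functor D C G \<and> adjunction D C G F \<phi>)"

definition full_subcategory :: "('o, 'm) category \<Rightarrow> ('o \<Rightarrow> bool) \<Rightarrow> ('o, 'm) category" where
  "full_subcategory C P =
     \<lparr>obj = {X \<in> obj C. P X}, homs = homs C, ide = ide C, cmp = cmp C\<rparr>"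

definition inclusion :: "('o, 'm, 'o, 'm) functor_data" where
  "inclusion = \<lparr>on_obj = (\<lambda>X. X), on_hom = (\<lambda>X Y f. f)\<rparr>"


section \<open>Categories of fractions\<close>

text \<open>
  \<open>S X Y\<close> is the set of morphisms \<open>X \<rightarrow> Y\<close> to be inverted. A roof \<open>(Z, s, f)\<close> from \<open>X\<close> to \<open>Y\<close> is a
  diagram \<open>X \<leftarrow> Z \<rightarrow> Y\<close> whose left leg \<open>s\<close> is to be inverted; it represents \<open>f s\<^sup>-\<^sup>1\<close>. Two roofs are
  equivalent if a third roof maps to both. For the morphisms with cone in a triangulated
  subcategory this is the usual construction of the Verdier quotient.
\<close>

definition roofs ::
  "('o, 'm) category \<Rightarrow> ('o \<Rightarrow> 'o \<Rightarrow> 'm set) \<Rightarrow> 'o \<Rightarrow> 'o \<Rightarrow> ('o \<times> 'm \<times> 'm) set" where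
  "roofs C S X Y = {(Z, s, f). Z \<in> obj C \<and> s \<in> S Z X \<and> f \<in> homs C Z Y}"

definition roof_rel ::
  "('o, 'm) category \<Rightarrow> ('o \<Rightarrow> 'o \<Rightarrow> 'm set) \<Rightarrow> 'o \<Rightarrow> 'o \<Rightarrow>
   (('o \<times> 'm \<times> 'm) \<times> ('o \<times> 'm \<times> 'm)) set" where
  "roof_rel C S X Y =
     {((Z, s, f), (Z', s', f')).
        (Z, s, f) \<in> roofs C S X Y \<and> (Z', s', f') \<in> roofs C S X Y \<and>
        (\<exists>Z'' s'' f'' u v. (Z'', s'', f'') \<in> roofs C S X Y \<and>
           u \<in> homs C Z'' Z \<and> v \<in> homs C Z'' Z' \<and>
           cmp C Z'' Z X s u = s'' \<and> cmp C Z'' Z' X s' v = s'' \<and>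
           cmp C Z'' Z Y f u = f'' \<and> cmp C Z'' Z' Y f' v = f'')}"

text \<open>
  The composite of \<open>X \<leftarrow> Z \<rightarrow> Y\<close> and \<open>Y \<leftarrow> W \<rightarrow> T\<close> is the class of \<open>X \<leftarrow> V \<rightarrow> T\<close> for any commutative
  square with \<open>p : V \<rightarrow> Z\<close> in \<open>S\<close> and \<open>q : V \<rightarrow> W\<close>. The union below runs over all representatives and
  all such squares; whenever \<open>S\<close> admits a calculus of right fractions, the square exists and all the
  classes in the union coincide.
\<close>

definition fractions ::
  "('o, 'm) category \<Rightarrow> ('o \<Rightarrow> 'o \<Rightarrow> 'm set) \<Rightarrow> ('o, ('o \<times> 'm \<times> 'm) set) category" where
  "fractions C S =
     \<lparr>obj = obj C,
      homs = (\<lambda>X Y. roofs C S X Y // roof_rel C S X Y),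
      ide = (\<lambda>X. roof_rel C S X X `` {(X, ide C X, ide C X)}),
      cmp = (\<lambda>X Y T b a.
        \<Union> {roof_rel C S X T `` {(V, cmp C V Z X s p, cmp C V W T g q)} | Z s f W t g V p q.
             (Z, s, f) \<in> a \<and> (W, t, g) \<in> b \<and> V \<in> obj C \<and> p \<in> S V Z \<and> q \<in> homs C V W \<and>
             cmp C V Z Y f p = cmp C V W Y t q})\<rparr>"

definition fractions_functor ::
  "('o, 'm) category \<Rightarrow> ('o \<Rightarrow> 'o \<Rightarrow> 'm set) \<Rightarrow> ('o, 'm, 'o, ('o \<times> 'm \<times> 'm) set) functor_data" where
  "fractions_functor C S =
     \<lparr>on_obj = (\<lambda>X. X), on_hom = (\<lambda>X Y f. roof_rel C S X Y `` {(X, ide C X, f)})\<rparr>"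


section \<open>Modules and chain complexes\<close>

text \<open>The polynomials with integer coefficients in the indeterminates from \<open>I\<close>; a monomial is its
  finitely supported family of exponents.\<close>

definition polynomial_ring :: "'i set \<Rightarrow> (('i \<Rightarrow>\<^sub>0 nat) \<Rightarrow>\<^sub>0 int) ring" where
  "polynomial_ring I =
     \<lparr>carrier = {p. \<forall>m\<in>Poly_Mapping.keys p. Poly_Mapping.keys m \<subseteq> I},
      mult = (*), one = 1, zero = 0, add = (+)\<rparr>"

definition module_homs ::
  "('r, 'c) ring_scheme \<Rightarrow> ('r, 'a, 'd) module_scheme \<Rightarrow> ('r, 'b, 'e) module_scheme \<Rightarrow> ('a \<Rightarrow> 'b) set" where
  "module_homs R M N =
     {f \<in> carrier M \<rightarrow>\<^sub>E carrier N.
        (\<forall>x\<in>carrier M. \<forall>y\<in>carrier M. f (x \<oplus>\<^bsub>M\<^esub> y) = f x \<oplus>\<^bsub>N\<^esub> f y) \<and>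
        (\<forall>r\<in>carrier R. \<forall>x\<in>carrier M. f (r \<odot>\<^bsub>M\<^esub> x) = r \<odot>\<^bsub>N\<^esub> f x)}"

text \<open>Complexes are graded homologically: \<open>bd X n\<close> is the differential from degree \<open>n\<close> to degree
  \<open>n - 1\<close>.\<close>

record ('r, 'a) chain_complex =
  deg :: "int \<Rightarrow> ('r, 'a) module"
  bd :: "int \<Rightarrow> 'a \<Rightarrow> 'a"

definition is_chain_complex :: "('r, 'c) ring_scheme \<Rightarrow> ('r, 'a) chain_complex \<Rightarrow> bool" where
  "is_chain_complex R X \<longleftrightarrow>
     (\<forall>n. module R (deg X n)) \<and>
     (\<forall>n. bd X n \<in> module_homs R (deg X n) (deg X (n - 1))) \<and>
     (\<forall>n. \<forall>x\<in>carrier (deg X n). bd X (n - 1) (bd X n x) = \<zero>\<^bsub>deg X (n - 2)\<^esub>)"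

definition acyclic_complex :: "('r, 'a) chain_complex \<Rightarrow> bool" where
  "acyclic_complex X \<longleftrightarrow>
     (\<forall>n. {x \<in> carrier (deg X n). bd X n x = \<zero>\<^bsub>deg X (n - 1)\<^esub>} =
          bd X (n + 1) ` carrier (deg X (n + 1)))"

definition chain_maps ::
  "('r, 'c) ring_scheme \<Rightarrow> ('r, 'a) chain_complex \<Rightarrow> ('r, 'a) chain_complex \<Rightarrow> (int \<Rightarrow> 'a \<Rightarrow> 'a) set" where
  "chain_maps R X Y =
     {f. (\<forall>n. f n \<in> module_homs R (deg X n) (deg Y n)) \<and>
         (\<forall>n. \<forall>x\<in>carrier (deg X n). f (n - 1) (bd X n x) = bd Y n (f n x))}"

definition homotopy_rel ::
  "('r, 'c) ring_scheme \<Rightarrow> ('r, 'a) chain_complex \<Rightarrow> ('r, 'a) chain_complex \<Rightarrow>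
   ((int \<Rightarrow> 'a \<Rightarrow> 'a) \<times> (int \<Rightarrow> 'a \<Rightarrow> 'a)) set" where
  "homotopy_rel R X Y =
     {(f, g). f \<in> chain_maps R X Y \<and> g \<in> chain_maps R X Y \<and>
        (\<exists>h. (\<forall>n. h n \<in> module_homs R (deg X n) (deg Y (n + 1))) \<and>
             (\<forall>n. \<forall>x\<in>carrier (deg X n).
                f n x = g n x \<oplus>\<^bsub>deg Y n\<^esub> (bd Y (n + 1) (h n x) \<oplus>\<^bsub>deg Y n\<^esub> h (n - 1) (bd X n x))))}"


section \<open>The homotopy category and the derived category of small modules\<close>

context universe
begin

definition small :: "'u set \<Rightarrow> bool" where
  "small S \<longleftrightarrow> (\<exists>a. elts a = S)"

definition R :: "(('u \<Rightarrow>\<^sub>0 nat) \<Rightarrow>\<^sub>0 int) ring" where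
  "R = polynomial_ring {a. ordinal elts a}"

text \<open>Homotopy is compatible with composition, so the union in \<open>cmp\<close> runs over a single class.\<close>

definition K :: "((('u \<Rightarrow>\<^sub>0 nat) \<Rightarrow>\<^sub>0 int, 'u) chain_complex, (int \<Rightarrow> 'u \<Rightarrow> 'u) set) category" where
  "K =
     \<lparr>obj = {X. is_chain_complex R X \<and> (\<forall>n. small (carrier (deg X n)))},
      homs = (\<lambda>X Y. chain_maps R X Y // homotopy_rel R X Y),
      ide = (\<lambda>X. homotopy_rel R X X `` {\<lambda>n. \<lambda>x\<in>carrier (deg X n). x}),
      cmp = (\<lambda>X Y Z b a. \<Union>f\<in>a. \<Union>g\<in>b.
        homotopy_rel R X Z `` {\<lambda>n. compose (carrier (deg X n)) (g n) (f n)})\<rparr>"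

definition A :: "((('u \<Rightarrow>\<^sub>0 nat) \<Rightarrow>\<^sub>0 int, 'u) chain_complex, (int \<Rightarrow> 'u \<Rightarrow> 'u) set) category" where
  "A = full_subcategory K acyclic_complex"

text \<open>Kuratowski pairs inside the universe. They serve only to place the direct sum of two small
  modules in the universe again.\<close>

definition set_of :: "'u set \<Rightarrow> 'u" where
  "set_of S = (THE a. elts a = S)"

definition pair :: "'u \<Rightarrow> 'u \<Rightarrow> 'u" where
  "pair x y = set_of {set_of {x}, set_of {x, y}}"

definition pfst :: "'u \<Rightarrow> 'u" where
  "pfst p = (THE x. \<exists>y. p = pair x y)"

definition psnd :: "'u \<Rightarrow> 'u" where
  "psnd p = (THE y. \<exists>x. p = pair x y)"

text \<open>The fields \<open>mult\<close> and \<open>one\<close> of a module record play no role.\<close>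

definition direct_sum :: "('r, 'u) module \<Rightarrow> ('r, 'u) module \<Rightarrow> ('r, 'u) module" where
  "direct_sum M N =
     \<lparr>carrier = {pair x y | x y. x \<in> carrier M \<and> y \<in> carrier N},
      mult = undefined, one = undefined,
      zero = pair \<zero>\<^bsub>M\<^esub> \<zero>\<^bsub>N\<^esub>,
      add = (\<lambda>p q. pair (pfst p \<oplus>\<^bsub>M\<^esub> pfst q) (psnd p \<oplus>\<^bsub>N\<^esub> psnd q)),
      smult = (\<lambda>r p. pair (r \<odot>\<^bsub>M\<^esub> pfst p) (r \<odot>\<^bsub>N\<^esub> psnd p))\<rparr>"

text \<open>In degree \<open>n\<close> the mapping cone of \<open>f : X \<rightarrow> Y\<close> is the direct sum of \<open>X\<close> in degree \<open>n - 1\<close> and \<open>Y\<close>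
  in degree \<open>n\<close>, and its differential sends \<open>(x, y)\<close> to \<open>(- d x, f x + d y)\<close>.\<close>

definition mapping_cone ::
  "('r, 'u) chain_complex \<Rightarrow> ('r, 'u) chain_complex \<Rightarrow> (int \<Rightarrow> 'u \<Rightarrow> 'u) \<Rightarrow> ('r, 'u) chain_complex" where
  "mapping_cone X Y f =
     \<lparr>deg = (\<lambda>n. direct_sum (deg X (n - 1)) (deg Y n)),
      bd = (\<lambda>n. \<lambda>p\<in>carrier (direct_sum (deg X (n - 1)) (deg Y n)).
        pair (\<ominus>\<^bsub>deg X (n - 2)\<^esub> bd X (n - 1) (pfst p))
             (f (n - 1) (pfst p) \<oplus>\<^bsub>deg Y (n - 1)\<^esub> bd Y n (psnd p)))\<rparr>"

text \<open>The morphisms of \<open>K\<close> that fit into a distinguished triangle with third vertex in \<open>A\<close>. The third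
  vertex is isomorphic to the mapping cone of any representative, and \<open>A\<close> is closed under
  isomorphism in \<open>K\<close>.\<close>

definition mor_A ::
  "(('u \<Rightarrow>\<^sub>0 nat) \<Rightarrow>\<^sub>0 int, 'u) chain_complex \<Rightarrow> (('u \<Rightarrow>\<^sub>0 nat) \<Rightarrow>\<^sub>0 int, 'u) chain_complex \<Rightarrow>
   (int \<Rightarrow> 'u \<Rightarrow> 'u) set set" where
  "mor_A X Y = {a \<in> homs K X Y. \<exists>f\<in>a. mapping_cone X Y f \<in> obj A}"

definition D where
  "D = fractions K mor_A"

definition Q where
  "Q = fractions_functor K mor_A"

definition has_Bousfield_localization :: bool where
  "has_Bousfield_localization \<longleftrightarrow> has_right_adjoint K D Q"

definition has_Bousfield_colocalization :: bool where
  "has_Bousfield_colocalization \<longleftrightarrow> has_left_adjoint K D Q"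

end

end

theory Submission
  imports Defs "HOL-Library.Equipollence" "HOL-Library.Product_Plus"
begin

text \<open>The ring \<open>R\<close> has a proper class of indeterminates, and this makes an Ext group a proper class. For an
  ordinal \<open>i\<close> let the indeterminate \<open>x\<^sub>i\<close> act on the dual numbers \<open>\<int>[\<epsilon>]\<close>, where \<open>\<epsilon>\<^sup>2 = 0\<close>, as
  multiplication by \<open>\<epsilon>\<close>, and let all other indeterminates act as zero. This is an extension of \<open>\<int>\<close> by
  \<open>\<int>\<close>, where all the indeterminates act on \<open>\<int>\<close> as zero, and no element of a module can play the
  part of the unit of \<open>\<int>[\<epsilon>]\<close> for two ordinals \<open>i\<close> and \<open>j\<close> at once: its product with \<open>x\<^sub>i\<close> would have to
  be nonzero for \<open>i\<close> and zero for \<open>j\<close>.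
  So a small module \<open>M\<close> that had to accommodate all these extensions would have at least one element
  for each ordinal, which contradicts the Burali-Forti theorem (\<open>not_small_ordinals\<close>).

  All complexes of the proof are built from two. The complex \<open>P\<^sub>i\<close> has \<open>\<int>[\<epsilon>]\<close> in each degree and
  multiplication by \<open>\<epsilon>\<close> as its differential; it is acyclic. The complex \<open>T\<close> has \<open>\<int>\<close> in each degree
  and zero differential. The differential of \<open>P\<^sub>i\<close> is the action of \<open>x\<^sub>i\<close>, which commutes with the
  components of a homotopy and is zero on \<open>T\<close>. Hence homotopic chain maps between \<open>P\<^sub>i\<close> and \<open>T\<close> are equal,
  and an equation between morphisms of \<open>K\<close> can be evaluated at elements.

  If the inclusion of the acyclic complexes had a right adjoint, then all the projections
  \<open>\<epsilon> : P\<^sub>i \<rightarrow> T\<close> would factor through one acyclic complex \<open>W\<close>. The images of the units in \<open>W\<close> are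
  pairwise different, for otherwise some projection would send a unit to a boundary of \<open>T\<close>, that is,
  to zero. Dually, a left adjoint would make all the embeddings \<open>\<int> \<rightarrow> \<int>[\<epsilon>]\<close>, regarded as chain maps
  \<open>T \<rightarrow> P\<^sub>i\<close>, factor through one acyclic \<open>W\<close>. The image of a generator is then a boundary \<open>d v\<close>, and
  the elements \<open>x\<^sub>i v\<close> are pairwise different.

  A Bousfield localization or colocalization would put each morphism set of \<open>D\<close> into bijection with a
  morphism set of \<open>K\<close>, and the latter are small (\<open>set_sized_homs_K\<close>). But the part of \<open>P\<^sub>i\<close> in
  nonnegative degrees is quasi-isomorphic to \<open>\<int>\<close> in degree zero, and with its projection to \<open>T\<close> it is a
  roof from that complex to \<open>T\<close>. Different ordinals give inequivalent roofs (\<open>ext_roof_inj\<close>), so this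
  morphism set of \<open>D\<close> is not small.\<close>

section \<open>Homotopy of chain maps\<close>

lemma module_homs_closed:
  "f \<in> module_homs R M N \<Longrightarrow> x \<in> carrier M \<Longrightarrow> f x \<in> carrier N"
  by (auto simp: module_homs_def)

lemma module_homs_add:
  "f \<in> module_homs R M N \<Longrightarrow> x \<in> carrier M \<Longrightarrow> y \<in> carrier M \<Longrightarrow>
    f (x \<oplus>\<^bsub>M\<^esub> y) = f x \<oplus>\<^bsub>N\<^esub> f y"
  by (auto simp: module_homs_def)

lemma module_homs_smult:
  "f \<in> module_homs R M N \<Longrightarrow> r \<in> carrier R \<Longrightarrow> x \<in> carrier M \<Longrightarrow>
    f (r \<odot>\<^bsub>M\<^esub> x) = r \<odot>\<^bsub>N\<^esub> f x"
  by (auto simp: module_homs_def)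

lemma module_homs_zero:
  assumes f: "f \<in> module_homs R M N" and M: "module R M" and N: "module R N"
  shows "f \<zero>\<^bsub>M\<^esub> = \<zero>\<^bsub>N\<^esub>"
proof -
  interpret M: module R M by fact
  interpret N: module R N by fact
  have c: "f \<zero>\<^bsub>M\<^esub> \<in> carrier N" using f by (auto intro: module_homs_closed)
  have "f \<zero>\<^bsub>M\<^esub> \<oplus>\<^bsub>N\<^esub> f \<zero>\<^bsub>M\<^esub> = f \<zero>\<^bsub>M\<^esub>"
    using module_homs_add[OF f, of "\<zero>\<^bsub>M\<^esub>" "\<zero>\<^bsub>M\<^esub>"] by simp
  then show ?thesis using c by (simp add: N.add.l_cancel_one)
qed

lemma module_homs_neg:
  assumes f: "f \<in> module_homs R M N" and M: "module R M" and N: "module R N"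
    and x: "x \<in> carrier M"
  shows "f (\<ominus>\<^bsub>M\<^esub> x) = \<ominus>\<^bsub>N\<^esub> f x"
proof -
  interpret M: module R M by fact
  interpret N: module R N by fact
  have c: "f x \<in> carrier N" "f (\<ominus>\<^bsub>M\<^esub> x) \<in> carrier N"
    using f x by (auto intro: module_homs_closed)
  have "f (\<ominus>\<^bsub>M\<^esub> x) \<oplus>\<^bsub>N\<^esub> f x = f (\<ominus>\<^bsub>M\<^esub> x \<oplus>\<^bsub>M\<^esub> x)"
    using module_homs_add[OF f] x by simp
  also have "\<dots> = \<zero>\<^bsub>N\<^esub>" using x module_homs_zero[OF f M N] by (simp add: M.l_neg)
  finally show ?thesis using c by (metis N.minus_equality)
qed

lemma module_homs_compose:
  assumes "f \<in> module_homs R M N" "g \<in> module_homs R N P" "module R M"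
  shows "compose (carrier M) g f \<in> module_homs R M P"
proof -
  interpret M: module R M by fact
  note c = module_homs_closed[OF assms(1)]
  show ?thesis unfolding module_homs_def
    using c module_homs_closed[OF assms(2)]
    by (auto simp: compose_def module_homs_add[OF assms(1)] module_homs_add[OF assms(2)]
        module_homs_smult[OF assms(1)] module_homs_smult[OF assms(2)])
qed

lemma module_homs_sum:
  assumes f: "f \<in> module_homs R M N" and g: "g \<in> module_homs R M N"
    and M: "module R M" and N: "module R N"
  shows "(\<lambda>x\<in>carrier M. f x \<oplus>\<^bsub>N\<^esub> g x) \<in> module_homs R M N"
proof -
  interpret M: module R M by fact
  interpret N: module R N by fact
  note c = module_homs_closed[OF f] module_homs_closed[OF g]
  show ?thesis unfolding module_homs_def
    using c
    by (auto simp: module_homs_add[OF f] module_homs_add[OF g] module_homs_smult[OF f]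
        module_homs_smult[OF g] N.smult_r_distr N.add.m_ac)
qed

lemma module_homs_minus:
  assumes f: "f \<in> module_homs R M N" and M: "module R M" and N: "module R N"
  shows "(\<lambda>x\<in>carrier M. \<ominus>\<^bsub>N\<^esub> f x) \<in> module_homs R M N"
proof -
  interpret M: module R M by fact
  interpret N: module R N by fact
  note c = module_homs_closed[OF f]
  show ?thesis unfolding module_homs_def
    using c
    by (auto simp: module_homs_add[OF f] module_homs_smult[OF f] N.smult_r_minus N.minus_add)
qed

lemma module_homs_const_zero:
  assumes M: "module R M" and N: "module R N"
  shows "(\<lambda>x\<in>carrier M. \<zero>\<^bsub>N\<^esub>) \<in> module_homs R M N"
proof -
  interpret M: module R M by fact
  interpret N: module R N by fact
  show ?thesis unfolding module_homs_def by (auto)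
qed

lemma module_homs_id:
  assumes M: "module R M"
  shows "(\<lambda>x\<in>carrier M. x) \<in> module_homs R M M"
proof -
  interpret M: module R M by fact
  show ?thesis unfolding module_homs_def by auto
qed

lemma complex_module: "is_chain_complex R X \<Longrightarrow> module R (deg X n)"
  by (simp add: is_chain_complex_def)

lemma complex_bd: "is_chain_complex R X \<Longrightarrow> bd X n \<in> module_homs R (deg X n) (deg X (n - 1))"
  by (simp add: is_chain_complex_def)

lemma complex_bd_bd:
  "is_chain_complex R X \<Longrightarrow> x \<in> carrier (deg X n) \<Longrightarrow> bd X (n - 1) (bd X n x) = \<zero>\<^bsub>deg X (n - 2)\<^esub>"
  by (simp add: is_chain_complex_def)

lemma complex_bd_up:
  "is_chain_complex R X \<Longrightarrow> bd X (n + 1) \<in> module_homs R (deg X (n + 1)) (deg X n)"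
  using complex_bd[of R X "n + 1"] by simp

lemma chain_maps_hom: "f \<in> chain_maps R X Y \<Longrightarrow> f n \<in> module_homs R (deg X n) (deg Y n)"
  by (simp add: chain_maps_def)

lemma chain_maps_bd:
  "f \<in> chain_maps R X Y \<Longrightarrow> x \<in> carrier (deg X n) \<Longrightarrow> f (n - 1) (bd X n x) = bd Y n (f n x)"
  by (simp add: chain_maps_def)

lemma chain_maps_id:
  assumes X: "is_chain_complex R X"
  shows "(\<lambda>n. \<lambda>x\<in>carrier (deg X n). x) \<in> chain_maps R X X"
  using module_homs_id[OF complex_module[OF X]] module_homs_closed[OF complex_bd[OF X]]
  by (auto simp: chain_maps_def)

lemma chain_maps_compose:
  assumes X: "is_chain_complex R X" and f: "f \<in> chain_maps R X Y" and g: "g \<in> chain_maps R Y Z"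
  shows "(\<lambda>n. compose (carrier (deg X n)) (g n) (f n)) \<in> chain_maps R X Z"
  using module_homs_compose[OF chain_maps_hom[OF f] chain_maps_hom[OF g] complex_module[OF X]]
    module_homs_closed[OF complex_bd[OF X]] module_homs_closed[OF chain_maps_hom[OF f]]
    chain_maps_bd[OF f] chain_maps_bd[OF g]
  by (auto simp: chain_maps_def compose_def)

definition homotopy where
  "homotopy R X Y f g h \<longleftrightarrow>
     (\<forall>n. h n \<in> module_homs R (deg X n) (deg Y (n + 1))) \<and>
     (\<forall>n. \<forall>x\<in>carrier (deg X n).
        f n x = g n x \<oplus>\<^bsub>deg Y n\<^esub> (bd Y (n + 1) (h n x) \<oplus>\<^bsub>deg Y n\<^esub> h (n - 1) (bd X n x)))"

lemma homotopy_rel_iff: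
  "(f, g) \<in> homotopy_rel R X Y \<longleftrightarrow>
     f \<in> chain_maps R X Y \<and> g \<in> chain_maps R X Y \<and> (\<exists>h. homotopy R X Y f g h)"
  by (auto simp: homotopy_rel_def homotopy_def)

lemma homotopy_closed:
  assumes "is_chain_complex R X" "is_chain_complex R Y" "homotopy R X Y f g h" "x \<in> carrier (deg X n)"
  shows "h n x \<in> carrier (deg Y (n + 1))" "bd Y (n + 1) (h n x) \<in> carrier (deg Y n)"
    "h (n - 1) (bd X n x) \<in> carrier (deg Y n)"
proof -
  have h: "h m \<in> module_homs R (deg X m) (deg Y (m + 1))" for m
    using assms(3) by (simp add: homotopy_def)
  show "h n x \<in> carrier (deg Y (n + 1))" using module_homs_closed[OF h assms(4)] .
  then show "bd Y (n + 1) (h n x) \<in> carrier (deg Y n)"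
    using module_homs_closed[OF complex_bd_up[OF assms(2)]] by blast
  show "h (n - 1) (bd X n x) \<in> carrier (deg Y n)"
    using module_homs_closed[OF h, of "bd X n x" "n - 1"]
      module_homs_closed[OF complex_bd[OF assms(1)] assms(4)] by simp
qed

lemma homotopy_refl:
  assumes X: "is_chain_complex R X" and Y: "is_chain_complex R Y" and f: "f \<in> chain_maps R X Y"
  shows "homotopy R X Y f f (\<lambda>n. \<lambda>x\<in>carrier (deg X n). \<zero>\<^bsub>deg Y (n + 1)\<^esub>)"
  unfolding homotopy_def
proof (intro conjI allI ballI)
  show "(\<lambda>x\<in>carrier (deg X n). \<zero>\<^bsub>deg Y (n + 1)\<^esub>) \<in> module_homs R (deg X n) (deg Y (n + 1))" for n
    using module_homs_const_zero complex_module X Y by blast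
  fix n x assume x: "x \<in> carrier (deg X n)"
  interpret module R "deg Y n" using complex_module[OF Y] .
  show "f n x = f n x \<oplus>\<^bsub>deg Y n\<^esub>
     (bd Y (n + 1) ((\<lambda>x\<in>carrier (deg X n). \<zero>\<^bsub>deg Y (n + 1)\<^esub>) x) \<oplus>\<^bsub>deg Y n\<^esub>
      (\<lambda>x\<in>carrier (deg X (n - 1)). \<zero>\<^bsub>deg Y (n - 1 + 1)\<^esub>) (bd X n x))"
    using x module_homs_closed[OF complex_bd[OF X] x] module_homs_closed[OF chain_maps_hom[OF f] x]
      module_homs_zero[OF complex_bd_up[OF Y] complex_module[OF Y] complex_module[OF Y]]
    by simp
qed

lemma homotopy_sym:
  assumes X: "is_chain_complex R X" and Y: "is_chain_complex R Y"
    and g: "g \<in> chain_maps R X Y" and h: "homotopy R X Y f g h"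
  shows "homotopy R X Y g f (\<lambda>n. \<lambda>x\<in>carrier (deg X n). \<ominus>\<^bsub>deg Y (n + 1)\<^esub> h n x)"
  unfolding homotopy_def
proof (intro conjI allI ballI)
  show "(\<lambda>x\<in>carrier (deg X n). \<ominus>\<^bsub>deg Y (n + 1)\<^esub> h n x) \<in> module_homs R (deg X n) (deg Y (n + 1))" for n
    using module_homs_minus[OF _ complex_module[OF X] complex_module[OF Y]] h
    by (simp add: homotopy_def)
  fix n x assume x: "x \<in> carrier (deg X n)"
  interpret module R "deg Y n" using complex_module[OF Y] .
  note c = homotopy_closed[OF X Y h x] module_homs_closed[OF chain_maps_hom[OF g] x]
    module_homs_closed[OF complex_bd[OF X] x]
  have "bd Y (n + 1) (\<ominus>\<^bsub>deg Y (n + 1)\<^esub> h n x) = \<ominus>\<^bsub>deg Y n\<^esub> bd Y (n + 1) (h n x)"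
    using module_homs_neg[OF complex_bd_up[OF Y] complex_module[OF Y] complex_module[OF Y] c(1)] .
  moreover have "f n x = g n x \<oplus>\<^bsub>deg Y n\<^esub> (bd Y (n + 1) (h n x) \<oplus>\<^bsub>deg Y n\<^esub> h (n - 1) (bd X n x))"
    using h x by (simp add: homotopy_def)
  ultimately show "g n x = f n x \<oplus>\<^bsub>deg Y n\<^esub>
     (bd Y (n + 1) ((\<lambda>x\<in>carrier (deg X n). \<ominus>\<^bsub>deg Y (n + 1)\<^esub> h n x) x) \<oplus>\<^bsub>deg Y n\<^esub>
      (\<lambda>x\<in>carrier (deg X (n - 1)). \<ominus>\<^bsub>deg Y (n - 1 + 1)\<^esub> h (n - 1) x) (bd X n x))"
    using x c by (simp add: a_assoc minus_add[symmetric] r_neg)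
qed

lemma homotopy_trans:
  assumes X: "is_chain_complex R X" and Y: "is_chain_complex R Y"
    and e: "e \<in> chain_maps R X Y"
    and h: "homotopy R X Y f g h" and k: "homotopy R X Y g e k"
  shows "homotopy R X Y f e (\<lambda>n. \<lambda>x\<in>carrier (deg X n). h n x \<oplus>\<^bsub>deg Y (n + 1)\<^esub> k n x)"
  unfolding homotopy_def
proof (intro conjI allI ballI)
  show "(\<lambda>x\<in>carrier (deg X n). h n x \<oplus>\<^bsub>deg Y (n + 1)\<^esub> k n x) \<in> module_homs R (deg X n) (deg Y (n + 1))" for n
    using module_homs_sum[OF _ _ complex_module[OF X] complex_module[OF Y]] h k
    by (simp add: homotopy_def)
  fix n x assume x: "x \<in> carrier (deg X n)"
  interpret module R "deg Y n" using complex_module[OF Y] .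
  note c = homotopy_closed[OF X Y h x] homotopy_closed[OF X Y k x]
    module_homs_closed[OF chain_maps_hom[OF e] x]
    module_homs_closed[OF complex_bd[OF X] x]
  have "bd Y (n + 1) (h n x \<oplus>\<^bsub>deg Y (n + 1)\<^esub> k n x) = bd Y (n + 1) (h n x) \<oplus>\<^bsub>deg Y n\<^esub> bd Y (n + 1) (k n x)"
    using module_homs_add[OF complex_bd_up[OF Y] c(1) c(4)] .
  moreover have "f n x = g n x \<oplus>\<^bsub>deg Y n\<^esub> (bd Y (n + 1) (h n x) \<oplus>\<^bsub>deg Y n\<^esub> h (n - 1) (bd X n x))"
    "g n x = e n x \<oplus>\<^bsub>deg Y n\<^esub> (bd Y (n + 1) (k n x) \<oplus>\<^bsub>deg Y n\<^esub> k (n - 1) (bd X n x))"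
    using h k x by (auto simp: homotopy_def)
  ultimately show "f n x = e n x \<oplus>\<^bsub>deg Y n\<^esub>
     (bd Y (n + 1) ((\<lambda>x\<in>carrier (deg X n). h n x \<oplus>\<^bsub>deg Y (n + 1)\<^esub> k n x) x) \<oplus>\<^bsub>deg Y n\<^esub>
      (\<lambda>x\<in>carrier (deg X (n - 1)). h (n - 1) x \<oplus>\<^bsub>deg Y (n - 1 + 1)\<^esub> k (n - 1) x) (bd X n x))"
    using x c by (simp add: a_ac)
qed

lemma homotopy_rel_equiv:
  assumes X: "is_chain_complex R X" and Y: "is_chain_complex R Y"
  shows "equiv (chain_maps R X Y) (homotopy_rel R X Y)"
proof (rule equivI)
  show "homotopy_rel R X Y \<subseteq> chain_maps R X Y \<times> chain_maps R X Y"
    by (auto simp: homotopy_rel_iff)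
  show "refl_on (chain_maps R X Y) (homotopy_rel R X Y)"
    using homotopy_refl[OF X Y] unfolding refl_on_def homotopy_rel_iff by blast
  show "sym (homotopy_rel R X Y)"
    using homotopy_sym[OF X Y] unfolding sym_def homotopy_rel_iff by blast
  show "trans (homotopy_rel R X Y)"
    using homotopy_trans[OF X Y] unfolding trans_def homotopy_rel_iff by blast
qed

lemma homotopy_compose_left:
  assumes X: "is_chain_complex R X" and Y: "is_chain_complex R Y" and Z: "is_chain_complex R Z"
    and f: "f \<in> chain_maps R X Y" and f': "f' \<in> chain_maps R X Y" and g: "g \<in> chain_maps R Y Z"
    and h: "homotopy R X Y f f' h"
  shows "homotopy R X Z (\<lambda>n. compose (carrier (deg X n)) (g n) (f n))
     (\<lambda>n. compose (carrier (deg X n)) (g n) (f' n))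
     (\<lambda>n. compose (carrier (deg X n)) (g (n + 1)) (h n))"
  unfolding homotopy_def
proof (intro conjI allI ballI)
  show "compose (carrier (deg X n)) (g (n + 1)) (h n) \<in> module_homs R (deg X n) (deg Z (n + 1))" for n
    using module_homs_compose[OF _ chain_maps_hom[OF g] complex_module[OF X]] h
    by (simp add: homotopy_def)
  fix n x assume x: "x \<in> carrier (deg X n)"
  interpret module R "deg Y n" using complex_module[OF Y] .
  note c = homotopy_closed[OF X Y h x] module_homs_closed[OF chain_maps_hom[OF f'] x]
    module_homs_closed[OF complex_bd[OF X] x]
  have "g n (bd Y (n + 1) (h n x)) = bd Z (n + 1) (g (n + 1) (h n x))"
    using chain_maps_bd[OF g, of "h n x" "n + 1"] c by simp
  moreover have "f n x = f' n x \<oplus>\<^bsub>deg Y n\<^esub> (bd Y (n + 1) (h n x) \<oplus>\<^bsub>deg Y n\<^esub> h (n - 1) (bd X n x))"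
    using h x by (simp add: homotopy_def)
  ultimately show "compose (carrier (deg X n)) (g n) (f n) x =
    compose (carrier (deg X n)) (g n) (f' n) x \<oplus>\<^bsub>deg Z n\<^esub>
     (bd Z (n + 1) (compose (carrier (deg X n)) (g (n + 1)) (h n) x) \<oplus>\<^bsub>deg Z n\<^esub>
      compose (carrier (deg X (n - 1))) (g (n - 1 + 1)) (h (n - 1)) (bd X n x))"
    using x c by (simp add: compose_eq module_homs_add[OF chain_maps_hom[OF g]])
qed

lemma homotopy_compose_right:
  assumes X: "is_chain_complex R X" and Y: "is_chain_complex R Y" and Z: "is_chain_complex R Z"
    and f: "f \<in> chain_maps R X Y"
    and h: "homotopy R Y Z g g' h"
  shows "homotopy R X Z (\<lambda>n. compose (carrier (deg X n)) (g n) (f n))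
     (\<lambda>n. compose (carrier (deg X n)) (g' n) (f n))
     (\<lambda>n. compose (carrier (deg X n)) (h n) (f n))"
  unfolding homotopy_def
proof (intro conjI allI ballI)
  show "compose (carrier (deg X n)) (h n) (f n) \<in> module_homs R (deg X n) (deg Z (n + 1))" for n
    using h by (auto simp: homotopy_def intro!: module_homs_compose[OF chain_maps_hom[OF f] _ complex_module[OF X]])
  fix n x assume x: "x \<in> carrier (deg X n)"
  note c = module_homs_closed[OF chain_maps_hom[OF f] x]
    module_homs_closed[OF complex_bd[OF X] x]
  show "compose (carrier (deg X n)) (g n) (f n) x =
    compose (carrier (deg X n)) (g' n) (f n) x \<oplus>\<^bsub>deg Z n\<^esub>
     (bd Z (n + 1) (compose (carrier (deg X n)) (h n) (f n) x) \<oplus>\<^bsub>deg Z n\<^esub>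
      compose (carrier (deg X (n - 1))) (h (n - 1)) (f (n - 1)) (bd X n x))"
    using h x c chain_maps_bd[OF f x] by (simp add: compose_eq homotopy_def)
qed

lemma homotopy_rel_compose:
  assumes X: "is_chain_complex R X" and Y: "is_chain_complex R Y" and Z: "is_chain_complex R Z"
    and f: "(f, f') \<in> homotopy_rel R X Y" and g: "(g, g') \<in> homotopy_rel R Y Z"
  shows "(\<lambda>n. compose (carrier (deg X n)) (g n) (f n),
          \<lambda>n. compose (carrier (deg X n)) (g' n) (f' n)) \<in> homotopy_rel R X Z"
proof -
  obtain h where h: "homotopy R X Y f f' h" using f by (auto simp: homotopy_rel_iff)
  obtain k where k: "homotopy R Y Z g g' k" using g by (auto simp: homotopy_rel_iff)
  have cm: "f \<in> chain_maps R X Y" "f' \<in> chain_maps R X Y" "g \<in> chain_maps R Y Z" "g' \<in> chain_maps R Y Z"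
    using f g by (auto simp: homotopy_rel_iff)
  show ?thesis
    using homotopy_trans[OF X Z _ homotopy_compose_left[OF X Y Z cm(1-3) h]
        homotopy_compose_right[OF X Y Z cm(2) k]] chain_maps_compose[OF X] cm
    unfolding homotopy_rel_iff by blast
qed

context universe
begin

section \<open>Ordinals and cardinality in a universe\<close>

lemma not_mem_self: "a \<notin> elts a"
  using foundation wf_not_sym by fastforce

lemma small_elts: "small (elts a)"
  unfolding small_def by blast

lemma small_empty: "small {}"
proof -
  obtain z where "\<And>y. (y, z) \<in> {(x, y). x \<in> elts y} \<Longrightarrow> y \<notin> UNIV"
    using foundation by (metis UNIV_I wfE_min)
  then have "elts z = {}" by auto
  then show ?thesis unfolding small_def by blast
qed

lemma small_subset:
  assumes "small S" "T \<subseteq> S"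
  shows "small T"
proof (cases "T = {}")
  case True
  then show ?thesis using small_empty by simp
next
  case False
  then obtain t where t: "t \<in> T" by blast
  obtain a where a: "elts a = S" using assms(1) small_def by blast
  obtain c where "elts c = (\<lambda>x. if x \<in> T then x else t) ` elts a" using replacement by blast
  also have "\<dots> = T" using a assms(2) t by auto
  finally show ?thesis unfolding small_def by blast
qed

lemma small_image: "small S \<Longrightarrow> small (f ` S)"
  using replacement unfolding small_def by metis

lemma ordinal_elts:
  assumes "ordinal elts a" "x \<in> elts a"
  shows "ordinal elts x"
proof -
  have sub: "elts x \<subseteq> elts a" using assms unfolding ordinal_def by blast
  \<comment> \<open>A failure of transitivity at \<open>z \<in> y \<in> x\<close> would give a membership cycle of length at most
     three, since \<open>z\<close> and \<open>x\<close> are comparable.\<close>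
  have "z \<in> elts x" if "y \<in> elts x" "z \<in> elts y" for y z
  proof (rule ccontr)
    assume nz: "z \<notin> elts x"
    have "y \<in> elts a" using sub that by blast
    then have "z \<in> elts a" using assms(1) that(2) unfolding ordinal_def by blast
    then have "z = x \<or> x \<in> elts z" using assms nz unfolding ordinal_def by blast
    then show False
    proof
      assume "z = x"
      then have "(y, x) \<in> {(x, y). x \<in> elts y}" "(x, y) \<in> {(x, y). x \<in> elts y}" using that by auto
      then show False using wf_not_sym[OF foundation] by blast
    next
      assume "x \<in> elts z"
      then have "(y, x) \<in> {(x, y). x \<in> elts y}\<^sup>+" "(x, y) \<in> {(x, y). x \<in> elts y}\<^sup>+"
        using that by (auto intro: trancl_into_trancl)
      then show False using wf_not_sym[OF wf_trancl[OF foundation]] by blast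
    qed
  qed
  moreover have "\<forall>y\<in>elts x. \<forall>z\<in>elts x. y \<in> elts z \<or> y = z \<or> z \<in> elts y"
    using assms(1) sub unfolding ordinal_def by blast
  ultimately show ?thesis unfolding ordinal_def by blast
qed

lemma ordinal_trans: "ordinal elts a \<Longrightarrow> x \<in> elts a \<Longrightarrow> elts x \<subseteq> elts a"
  unfolding ordinal_def by blast

text \<open>The smaller ordinal is the least element of the difference.\<close>

lemma ordinal_psubset_mem:
  assumes a: "ordinal elts a" and b: "ordinal elts b" and sub: "elts b \<subseteq> elts a" and ne: "b \<noteq> a"
  shows "b \<in> elts a"
proof -
  have "elts a - elts b \<noteq> {}" using sub ne extensionality by blast
  then obtain z where z: "z \<in> elts a - elts b"
    and min: "\<And>y. (y, z) \<in> {(x, y). x \<in> elts y} \<Longrightarrow> y \<notin> elts a - elts b"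
    using wfE_min[OF foundation] by (metis equals0I)
  have "elts z \<subseteq> elts b"
    using min ordinal_trans[OF a, of z] z by auto
  moreover have "elts b \<subseteq> elts z"
  proof
    fix y assume y: "y \<in> elts b"
    then have "y \<in> elts z \<or> y = z \<or> z \<in> elts y"
      using a sub z unfolding ordinal_def by blast
    moreover have "z \<notin> elts y" "y \<noteq> z" using y z ordinal_trans[OF b] by auto
    ultimately show "y \<in> elts z" by blast
  qed
  ultimately have "z = b" using extensionality by blast
  then show ?thesis using z by simp
qed

text \<open>The intersection of two ordinals is an initial segment of both, so it is a member of each of
  them that it differs from; it cannot be a member of both.\<close>

lemma ordinal_linear:
  assumes a: "ordinal elts a" and b: "ordinal elts b"
  shows "a \<in> elts b \<or> a = b \<or> b \<in> elts a"
proof -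
  obtain c where c: "elts c = elts a \<inter> elts b"
    using small_subset[OF small_elts Int_lower1] unfolding small_def by blast
  have oc: "ordinal elts c"
    using a b c unfolding ordinal_def by blast
  have "c \<in> elts a" if "c \<noteq> a" using ordinal_psubset_mem[OF a oc _ that] c by blast
  moreover have "c \<in> elts b" if "c \<noteq> b" using ordinal_psubset_mem[OF b oc _ that] c by blast
  ultimately show ?thesis using not_mem_self[of c] c by blast
qed

text \<open>This applies both to the class of all ordinals and to the set of the finite ones: each of them would
  be a member of itself if it were small, or finite, respectively.\<close>

lemma ordinal_of_ordinals:
  assumes "\<And>x. x \<in> elts a \<Longrightarrow> ordinal elts x" "\<And>x. x \<in> elts a \<Longrightarrow> elts x \<subseteq> elts a"
  shows "ordinal elts a"
  using assms ordinal_linear unfolding ordinal_def[of elts a] by blast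

lemma not_small_ordinals: "\<not> small {a. ordinal elts a}"
proof
  assume "small {a. ordinal elts a}"
  then obtain c where c: "elts c = {a. ordinal elts a}" unfolding small_def by blast
  have "ordinal elts c" by (rule ordinal_of_ordinals) (use c in \<open>auto intro: ordinal_elts\<close>)
  then show False using c not_mem_self[of c] by blast
qed

text \<open>Morphism sets of the categories at hand do not consist of elements of the universe, so their
  size is measured by injections into the sets of the universe.\<close>

definition set_sized :: "'b set \<Rightarrow> bool" where
  "set_sized S \<longleftrightarrow> (\<exists>a. S \<lesssim> elts a)"

lemma small_imp_set_sized: "small S \<Longrightarrow> set_sized S"
  unfolding small_def set_sized_def using lepoll_refl by metis

lemma set_sized_lepoll: "set_sized T \<Longrightarrow> S \<lesssim> T \<Longrightarrow> set_sized S"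
  unfolding set_sized_def by (meson lepoll_trans)

lemma set_sized_inj_on: "set_sized T \<Longrightarrow> inj_on f S \<Longrightarrow> f ` S \<subseteq> T \<Longrightarrow> set_sized S"
  by (erule set_sized_lepoll) (auto simp: lepoll_def)

lemma not_set_sized_ordinals: "\<not> set_sized {a. ordinal elts a}"
proof
  assume "set_sized {a. ordinal elts a}"
  then obtain c g where "{a. ordinal elts a} \<subseteq> g ` elts c"
    unfolding set_sized_def lepoll_iff by blast
  then have "small {a. ordinal elts a}"
    by (rule small_subset[OF small_image[OF small_elts]])
  then show False using not_small_ordinals by contradiction
qed

lemma set_sized_Pow:
  assumes "set_sized S"
  shows "set_sized (Pow S)"
proof -
  obtain a f where f: "inj_on f S" "f ` S \<subseteq> elts a"
    using assms unfolding set_sized_def lepoll_def by blast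
  obtain c where c: "elts c = {x. elts x \<subseteq> elts a}" using power by blast
  have "\<exists>x. elts x = f ` T" if "T \<subseteq> S" for T
    using small_subset[OF small_elts, of "f ` T" a] image_mono[OF that, of f] f(2)
    unfolding small_def by simp
  then obtain e where e: "\<And>T. T \<subseteq> S \<Longrightarrow> elts (e T) = f ` T" by metis
  have "inj_on e (Pow S)"
  proof (rule inj_onI)
    fix T T' assume T: "T \<in> Pow S" "T' \<in> Pow S" and "e T = e T'"
    then have "f ` T = f ` T'" using e[of T] e[of T'] by simp
    then show "T = T'" using inj_on_image_eq_iff[OF f(1)] T by simp
  qed
  moreover have "e ` Pow S \<subseteq> elts c"
  proof (rule image_subsetI)
    fix T assume T: "T \<in> Pow S"
    then have "elts (e T) \<subseteq> elts a" using e[of T] f(2) image_mono[of T S f] by simp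
    then show "e T \<in> elts c" using c by simp
  qed
  ultimately have "Pow S \<lesssim> elts c" unfolding lepoll_def by metis
  then show ?thesis unfolding set_sized_def by metis
qed

lemma elts_set_of: "small S \<Longrightarrow> elts (set_of S) = S"
  unfolding small_def set_of_def by (metis (mono_tags, lifting) extensionality theI)

lemma small_pair: "small {x, y}" using pairing small_def by metis

lemma small_singleton: "small {x}" using small_pair[of x x] by simp

lemma pair_eq_iff: "pair x y = pair x' y' \<longleftrightarrow> x = x' \<and> y = y'"
proof
  have inj: "{a, b} = {c, d}" if "set_of {a, b} = set_of {c, d}" for a b c d
    using elts_set_of small_pair that by metis
  assume "pair x y = pair x' y'"
  then have "{set_of {x}, set_of {x, y}} = {set_of {x'}, set_of {x', y'}}"
    unfolding pair_def by (rule inj)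
  then show "x = x' \<and> y = y'"
    using inj[of x x x' x'] inj[of x x x' y'] inj[of x y x' x'] inj[of x y x' y']
    by (auto simp: doubleton_eq_iff)
qed simp

lemma pfst_pair [simp]: "pfst (pair x y) = x"
  unfolding pfst_def pair_eq_iff by blast

lemma psnd_pair [simp]: "psnd (pair x y) = y"
  unfolding psnd_def pair_eq_iff by blast

lemma small_Pow_Pow:
  assumes "small S"
  shows "small {p. \<forall>q\<in>elts p. elts q \<subseteq> S}"
proof -
  obtain a where a: "elts a = S" using assms unfolding small_def by blast
  obtain b where b: "elts b = {x. elts x \<subseteq> elts a}" using power by blast
  obtain c where c: "elts c = {x. elts x \<subseteq> elts b}" using power by blast
  have "elts c = {p. \<forall>q\<in>elts p. elts q \<subseteq> S}" using a b c by auto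
  then show ?thesis unfolding small_def by blast
qed

lemma small_Un:
  assumes "small S" "small T"
  shows "small (S \<union> T)"
proof -
  obtain a b where ab: "elts a = S" "elts b = T" using assms unfolding small_def by blast
  obtain c where c: "elts c = {a, b}" using pairing by blast
  obtain d where "elts d = (\<Union>x\<in>elts c. elts x)" using union by blast
  then show ?thesis using c ab unfolding small_def by auto
qed

lemma small_pairs:
  assumes "small S" "small T"
  shows "small {pair x y | x y. x \<in> S \<and> y \<in> T}"
  by (rule small_subset[OF small_Pow_Pow[OF small_Un[OF assms]]])
    (auto simp: pair_def elts_set_of small_pair small_singleton)

lemma set_sized_Times:
  assumes "set_sized S" "set_sized T"
  shows "set_sized (S \<times> T)"
proof -
  obtain a f where f: "inj_on f S" "f ` S \<subseteq> elts a"
    using assms(1) unfolding set_sized_def lepoll_def by blast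
  obtain b g where g: "inj_on g T" "g ` T \<subseteq> elts b"
    using assms(2) unfolding set_sized_def lepoll_def by blast
  have "set_sized {pair x y | x y. x \<in> elts a \<and> y \<in> elts b}"
    by (intro small_imp_set_sized small_pairs small_elts)
  moreover have "inj_on (\<lambda>(x, y). pair (f x) (g y)) (S \<times> T)"
    using f(1) g(1) by (auto simp: inj_on_def pair_eq_iff)
  moreover have "(\<lambda>(x, y). pair (f x) (g y)) ` (S \<times> T) \<subseteq> {pair x y | x y. x \<in> elts a \<and> y \<in> elts b}"
    using f(2) g(2) by fast
  ultimately show ?thesis by (rule set_sized_inj_on)
qed

text \<open>The set of the finite ordinals is infinite, since it would otherwise be a finite ordinal and thus a
  member of itself.\<close>

lemma set_sized_countable:
  assumes "countable S"
  shows "set_sized S"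
proof -
  obtain w where w: "elts w = {n. ordinal elts n \<and> finite (elts n)}" using infinity by blast
  have ow: "ordinal elts w"
  proof (rule ordinal_of_ordinals)
    fix x assume x: "x \<in> elts w"
    then have ox: "ordinal elts x" and fx: "finite (elts x)" using w by auto
    show "ordinal elts x" by fact
    show "elts x \<subseteq> elts w"
      using ordinal_elts[OF ox] ordinal_trans[OF ox] finite_subset[OF _ fx] w by blast
  qed
  have "infinite (elts w)"
    using ow w not_mem_self[of w] by blast
  then have "(UNIV :: nat set) \<lesssim> elts w" using infinite_le_lepoll by blast
  moreover have "S \<lesssim> (UNIV :: nat set)" using assms inj_on_to_nat_on
    unfolding lepoll_def by blast
  ultimately show ?thesis unfolding set_sized_def using lepoll_trans by blast
qed

text \<open>A family of functions is determined by its graph.\<close>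

lemma set_sized_families:
  fixes S :: "'j \<Rightarrow> 'b set" and T :: "'j \<Rightarrow> 'c set"
  assumes J: "countable (UNIV :: 'j set)" and S: "set_sized (\<Union>n. S n)" and T: "set_sized (\<Union>n. T n)"
  shows "set_sized {f. \<forall>n. f n \<in> S n \<rightarrow>\<^sub>E T n}"
proof -
  let ?graph = "\<lambda>f. {(n, x, f n x) | n x. x \<in> S n}"
  have "set_sized (Pow ((UNIV :: 'j set) \<times> (\<Union>n. S n) \<times> (\<Union>n. T n)))"
    by (intro set_sized_Pow set_sized_Times set_sized_countable J S T)
  moreover have "inj_on ?graph {f. \<forall>n. f n \<in> S n \<rightarrow>\<^sub>E T n}"
  proof (intro inj_onI ext)
    fix f g n x
    assume fg: "f \<in> {f. \<forall>n. f n \<in> S n \<rightarrow>\<^sub>E T n}" "g \<in> {f. \<forall>n. f n \<in> S n \<rightarrow>\<^sub>E T n}"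
      and eq: "?graph f = ?graph g"
    show "f n x = g n x"
    proof (cases "x \<in> S n")
      case True
      then have "(n, x, f n x) \<in> ?graph f" by blast
      then have "(n, x, f n x) \<in> ?graph g" by (rule eq[THEN equalityD1, THEN subsetD])
      then show ?thesis by simp
    next
      case False
      have f: "f n \<in> S n \<rightarrow>\<^sub>E T n" and g: "g n \<in> S n \<rightarrow>\<^sub>E T n" using fg by simp_all
      show ?thesis using PiE_arb[OF f False] PiE_arb[OF g False] by simp
    qed
  qed
  moreover have "?graph ` {f. \<forall>n. f n \<in> S n \<rightarrow>\<^sub>E T n} \<subseteq> Pow ((UNIV :: 'j set) \<times> (\<Union>n. S n) \<times> (\<Union>n. T n))"
  proof (intro image_subsetI PowI subsetI)
    fix f y
    assume "f \<in> {f. \<forall>n. f n \<in> S n \<rightarrow>\<^sub>E T n}" and "y \<in> ?graph f"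
    then obtain n x where y: "y = (n, x, f n x)" "x \<in> S n" and f: "f n \<in> S n \<rightarrow>\<^sub>E T n" by blast
    then show "y \<in> UNIV \<times> (\<Union>n. S n) \<times> (\<Union>n. T n)" using PiE_mem[OF f y(2)] by blast
  qed
  ultimately show ?thesis by (rule set_sized_inj_on)
qed

lemma small_countable_Union:
  fixes S :: "'j \<Rightarrow> 'u set"
  assumes "countable (UNIV :: 'j set)" "\<And>n. small (S n)"
  shows "small (\<Union>n. S n)"
proof -
  obtain a and f :: "'j \<Rightarrow> 'u" where f: "inj f" "range f \<subseteq> elts a"
    using set_sized_countable[OF assms(1)] by (auto simp: set_sized_def lepoll_def)
  obtain b where b: "elts b = (\<lambda>i. set_of (S (inv_into UNIV f i))) ` elts a"
    using replacement[of "\<lambda>i. set_of (S (inv_into UNIV f i))" a] by (rule exE)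
  obtain c where c: "elts c = (\<Union>x\<in>elts b. elts x)" using union by blast
  have "(\<Union>n. S n) \<subseteq> elts c"
  proof (rule UN_least)
    fix n
    have "set_of (S n) \<in> elts b" using b f by (auto intro!: image_eqI[of _ _ "f n"])
    then show "S n \<subseteq> elts c" using c elts_set_of[OF assms(2)] by blast
  qed
  then show ?thesis using small_subset[OF small_elts] by blast
qed

end

section \<open>Polynomials\<close>

lemma polynomial_ring_simps [simp]:
  "p \<oplus>\<^bsub>polynomial_ring I\<^esub> q = p + q" "p \<otimes>\<^bsub>polynomial_ring I\<^esub> q = p * q"
  "\<one>\<^bsub>polynomial_ring I\<^esub> = 1" "\<zero>\<^bsub>polynomial_ring I\<^esub> = 0"
  "p \<in> carrier (polynomial_ring I) \<longleftrightarrow> (\<forall>m\<in>Poly_Mapping.keys p. Poly_Mapping.keys m \<subseteq> I)"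
  by (simp_all add: polynomial_ring_def)

lemma cring_polynomial_ring: "cring (polynomial_ring I)"
proof (rule cringI)
  have mult: "p * q \<in> carrier (polynomial_ring I)"
    if p: "p \<in> carrier (polynomial_ring I)" "q \<in> carrier (polynomial_ring I)"
    for p q :: "('a \<Rightarrow>\<^sub>0 nat) \<Rightarrow>\<^sub>0 int"
    unfolding polynomial_ring_simps
  proof
    fix k assume "k \<in> Poly_Mapping.keys (p * q)"
    then obtain a b where "k = a + b" "a \<in> Poly_Mapping.keys p" "b \<in> Poly_Mapping.keys q"
      using keys_mult[of p q] by blast
    then show "Poly_Mapping.keys k \<subseteq> I"
      using p keys_add[of a b] unfolding polynomial_ring_simps by blast
  qed
  have add: "p + q \<in> carrier (polynomial_ring I)"
    if "p \<in> carrier (polynomial_ring I)" "q \<in> carrier (polynomial_ring I)"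
    for p q :: "('a \<Rightarrow>\<^sub>0 nat) \<Rightarrow>\<^sub>0 int"
    using that keys_add[of p q] unfolding polynomial_ring_simps by blast
  have one: "1 \<in> carrier (polynomial_ring I)" by simp
  show "abelian_group (polynomial_ring I)"
  proof (rule abelian_groupI)
    show "\<exists>y\<in>carrier (polynomial_ring I). y \<oplus>\<^bsub>polynomial_ring I\<^esub> p = \<zero>\<^bsub>polynomial_ring I\<^esub>"
      if "p \<in> carrier (polynomial_ring I)" for p :: "('a \<Rightarrow>\<^sub>0 nat) \<Rightarrow>\<^sub>0 int"
      by (rule bexI[of _ "- p"]) (use that in simp_all)
  qed (simp_all only: add polynomial_ring_simps(1-4) ac_simps add_0_left add_0_right, simp)
  show "comm_monoid (polynomial_ring I)"
    by (rule comm_monoidI)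
      (simp_all only: mult one polynomial_ring_simps(1-4) ac_simps mult_1_left mult_1_right)
qed (simp add: distrib_right)

lemma add_eq_zero_iff_monomial:
  fixes l m :: "'i \<Rightarrow>\<^sub>0 nat"
  shows "l + m = 0 \<longleftrightarrow> l = 0 \<and> m = 0"
  by (auto simp: poly_mapping_eq_iff fun_eq_iff lookup_add)

lemma lookup_mult_zero:
  fixes p q :: "('i \<Rightarrow>\<^sub>0 nat) \<Rightarrow>\<^sub>0 int"
  shows "Poly_Mapping.lookup (p * q) 0 = Poly_Mapping.lookup p 0 * Poly_Mapping.lookup q 0"
proof -
  have "(\<Sum>m. Poly_Mapping.lookup q m when 0 = l + m) = (Poly_Mapping.lookup q 0 when l = 0)" for l
    using add_eq_zero_iff_monomial[of l] by (cases "l = 0") (auto simp: eq_commute[of 0])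
  then show ?thesis unfolding lookup_mult by (simp add: mult_when)
qed

text \<open>An indeterminate is not a product of two nonconstant monomials.\<close>

lemma add_eq_single_one_iff:
  fixes l m :: "'i \<Rightarrow>\<^sub>0 nat"
  shows "Poly_Mapping.single i 1 = l + m \<longleftrightarrow>
    (l = 0 \<and> m = Poly_Mapping.single i 1) \<or> (l = Poly_Mapping.single i 1 \<and> m = 0)"
proof
  assume eq: "Poly_Mapping.single i 1 = l + m"
  have "Poly_Mapping.lookup l j + Poly_Mapping.lookup m j = (1 when i = j)" for j
    using arg_cong[OF eq, of "\<lambda>k. Poly_Mapping.lookup k j"] by (simp add: lookup_add lookup_single)
  then have other: "Poly_Mapping.lookup l j = 0" "Poly_Mapping.lookup m j = 0" if "j \<noteq> i" for j
    using that by (metis add_is_0 when_simps(2))+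
  have "Poly_Mapping.lookup l i + Poly_Mapping.lookup m i = 1"
    using arg_cong[OF eq, of "\<lambda>k. Poly_Mapping.lookup k i"] by (simp add: lookup_add lookup_single)
  then consider "Poly_Mapping.lookup l i = 0" "Poly_Mapping.lookup m i = 1" | "Poly_Mapping.lookup l i = 1" "Poly_Mapping.lookup m i = 0" by linarith
  then show "(l = 0 \<and> m = Poly_Mapping.single i 1) \<or> (l = Poly_Mapping.single i 1 \<and> m = 0)"
  proof cases
    case 1
    then have "l = 0" "m = Poly_Mapping.single i 1"
      using other by (auto simp: poly_mapping_eq_iff fun_eq_iff lookup_single when_def) metis+
    then show ?thesis by simp
  next
    case 2
    then have "m = 0" "l = Poly_Mapping.single i 1"
      using other by (auto simp: poly_mapping_eq_iff fun_eq_iff lookup_single when_def) metis+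
    then show ?thesis by simp
  qed
qed auto

definition linear_coeff :: "'i \<Rightarrow> (('i \<Rightarrow>\<^sub>0 nat) \<Rightarrow>\<^sub>0 int) \<Rightarrow> int" where
  "linear_coeff i p = Poly_Mapping.lookup p (Poly_Mapping.single i 1)"

lemma single_one_nonzero: "Poly_Mapping.single i (1::nat) \<noteq> 0"
  by (metis lookup_single_eq lookup_zero one_neq_zero)

text \<open>The Leibniz rule at the origin.\<close>

lemma linear_coeff_mult:
  "linear_coeff i (p * q) = Poly_Mapping.lookup p 0 * linear_coeff i q + linear_coeff i p * Poly_Mapping.lookup q 0"
proof -
  let ?e = "Poly_Mapping.single i 1 :: 'a \<Rightarrow>\<^sub>0 nat"
  note ne = single_one_nonzero[of i]
  have "(\<Sum>m. Poly_Mapping.lookup q m when ?e = l + m) = (Poly_Mapping.lookup q ?e when l = 0) + (Poly_Mapping.lookup q 0 when l = ?e)" for l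
  proof -
    consider "l = 0" | "l = ?e" | "l \<noteq> 0" "l \<noteq> ?e" by blast
    then show ?thesis
    proof cases
      case 1
      then have "(\<lambda>m. Poly_Mapping.lookup q m when ?e = l + m) = (\<lambda>m. Poly_Mapping.lookup q m when m = ?e)" by (auto simp: when_def)
      then show ?thesis using 1 ne by simp
    next
      case 2
      then have "(\<lambda>m. Poly_Mapping.lookup q m when ?e = l + m) = (\<lambda>m. Poly_Mapping.lookup q m when m = 0)" by (auto simp: when_def)
      then show ?thesis using 2 ne by simp
    next
      case 3
      then have "\<not> ?e = l + m" for m using add_eq_single_one_iff[of i l m] by blast
      then show ?thesis using 3 by simp
    qed
  qed
  then have "Poly_Mapping.lookup (p * q) ?e = (\<Sum>l. Poly_Mapping.lookup p l * ((Poly_Mapping.lookup q ?e when l = 0) + (Poly_Mapping.lookup q 0 when l = ?e)))"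
    unfolding lookup_mult by simp
  also have "\<dots> = (\<Sum>l\<in>{0, ?e}. Poly_Mapping.lookup p l * ((Poly_Mapping.lookup q ?e when l = 0) + (Poly_Mapping.lookup q 0 when l = ?e)))"
    by (rule Sum_any.expand_superset) (auto simp: when_def split: if_splits)
  also have "\<dots> = Poly_Mapping.lookup p 0 * Poly_Mapping.lookup q ?e + Poly_Mapping.lookup p ?e * Poly_Mapping.lookup q 0"
    using ne by simp
  finally show ?thesis by (simp add: linear_coeff_def)
qed

section \<open>The modules\<close>

text \<open>These are the derivations of the polynomial ring at the origin, with values in the integers. They are
  the maps \<open>c\<close> for which sending \<open>p\<close> to \<open>p(0) + c(p) \<epsilon>\<close> is multiplicative, so each of them makes the
  dual numbers a module.\<close>

definition point_derivation :: "((('i \<Rightarrow>\<^sub>0 nat) \<Rightarrow>\<^sub>0 int) \<Rightarrow> int) \<Rightarrow> bool" where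
  "point_derivation c \<longleftrightarrow>
     (\<forall>p q. c (p + q) = c p + c q) \<and> (\<forall>p q. c (p * q) = Poly_Mapping.lookup p 0 * c q + c p * Poly_Mapping.lookup q 0)"

lemma point_derivation_zero: "point_derivation (\<lambda>p. 0)"
  by (simp add: point_derivation_def)

lemma point_derivation_linear_coeff: "point_derivation (linear_coeff i)"
  unfolding point_derivation_def using linear_coeff_mult by (auto simp: linear_coeff_def lookup_add)

lemma point_derivation_one: "point_derivation c \<Longrightarrow> c 1 = 0"
proof -
  assume "point_derivation c"
  then have "\<And>p q. c (p * q) = Poly_Mapping.lookup p 0 * c q + c p * Poly_Mapping.lookup q 0"
    unfolding point_derivation_def by blast
  from this[of 1 1] show ?thesis by simp
qed

text \<open>The pair \<open>(a, b)\<close> stands for the dual number \<open>a + b \<epsilon>\<close>, which is multiplied by \<open>p(0) + c(p) \<epsilon>\<close>.\<close>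

definition scale :: "((('i \<Rightarrow>\<^sub>0 nat) \<Rightarrow>\<^sub>0 int) \<Rightarrow> int) \<Rightarrow> (('i \<Rightarrow>\<^sub>0 nat) \<Rightarrow>\<^sub>0 int) \<Rightarrow> int \<times> int \<Rightarrow> int \<times> int" where
  "scale c p v = (Poly_Mapping.lookup p 0 * fst v, Poly_Mapping.lookup p 0 * snd v + c p * fst v)"

text \<open>Multiplication by \<open>\<epsilon>\<close>.\<close>

definition eps :: "int \<times> int \<Rightarrow> int \<times> int" where
  "eps v = (0, fst v)"

text \<open>The sets \<open>0\<close>, \<open>\<int>\<epsilon>\<close> and \<open>\<int>[\<epsilon>]\<close> are submodules whatever the derivation. On \<open>\<int>\<epsilon>\<close> the derivation
  has no effect: each polynomial acts through its constant term, so that \<open>\<int>\<epsilon>\<close> serves as the module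
  \<open>\<int>\<close> on which the indeterminates act as zero.\<close>

definition stable :: "(int \<times> int) set \<Rightarrow> bool" where
  "stable S \<longleftrightarrow> S = {0} \<or> S = {0} \<times> UNIV \<or> S = UNIV"

lemma stableD:
  assumes "stable S"
  shows "0 \<in> S" "v \<in> S \<Longrightarrow> w \<in> S \<Longrightarrow> v + w \<in> S" "v \<in> S \<Longrightarrow> - v \<in> S" "v \<in> S \<Longrightarrow> scale c p v \<in> S"
  using assms unfolding stable_def scale_def by (auto simp: zero_prod_def)

lemma eps_simps [simp]: "eps 0 = 0" "eps (eps v) = 0" "eps (v + w) = eps v + eps w" "eps (a, b) = (0, a)"
  "eps (- v) = - eps v"
  by (auto simp: eps_def zero_prod_def prod_eq_iff)

lemma eps_scale: "eps (scale c p v) = scale c' p (eps v)"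
  by (simp add: eps_def scale_def)

lemma scale_zero [simp]: "scale c p 0 = 0"
  by (simp add: scale_def zero_prod_def)

lemma scale_add: "scale c p (v + w) = scale c p v + scale c p w"
  by (simp add: scale_def algebra_simps)

context universe
begin

text \<open>The modules of the category have elements of the universe as their elements, and so the dual numbers
  are transported along an injection into the universe.\<close>

definition encode :: "int \<times> int \<Rightarrow> 'u" where
  "encode = (SOME e. inj e)"

definition decode :: "'u \<Rightarrow> int \<times> int" where
  "decode = inv_into UNIV encode"

lemma inj_code: "inj encode"
proof -
  have "\<exists>e :: int \<times> int \<Rightarrow> 'u. inj e"
    using set_sized_countable[of "UNIV :: (int \<times> int) set"] by (auto simp: set_sized_def lepoll_def)
  then show ?thesis unfolding encode_def by (rule someI_ex)
qed

lemma decode_code [simp]: "decode (encode v) = v"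
  unfolding decode_def using inj_code by simp

lemma encode_eq_iff [simp]: "encode v = encode w \<longleftrightarrow> v = w"
  using inj_code by (auto dest: injD)

lemma encode_mem_iff [simp]: "encode v \<in> encode ` S \<longleftrightarrow> v \<in> S"
  by auto

lemma small_code: "small (encode ` S)"
proof -
  have "small (\<Union>v. {encode v})" by (intro small_countable_Union small_singleton) auto
  then show ?thesis by (rule small_subset) auto
qed

definition jet_module ::
  "((('i \<Rightarrow>\<^sub>0 nat) \<Rightarrow>\<^sub>0 int) \<Rightarrow> int) \<Rightarrow> (int \<times> int) set \<Rightarrow> (('i \<Rightarrow>\<^sub>0 nat) \<Rightarrow>\<^sub>0 int, 'u) module" where
  "jet_module c S =
     \<lparr>carrier = encode ` S, mult = undefined, one = undefined, zero = encode 0,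
      add = (\<lambda>x y. encode (decode x + decode y)),
      smult = (\<lambda>p x. encode (scale c p (decode x)))\<rparr>"

lemma jet_module_simps [simp]:
  "carrier (jet_module c S) = encode ` S" "\<zero>\<^bsub>jet_module c S\<^esub> = encode 0"
  "x \<oplus>\<^bsub>jet_module c S\<^esub> y = encode (decode x + decode y)"
  "p \<odot>\<^bsub>jet_module c S\<^esub> x = encode (scale c p (decode x))"
  by (simp_all add: jet_module_def)

lemma cring_R: "cring R"
  unfolding R_def by (rule cring_polynomial_ring)

lemma R_simps [simp]: "p \<oplus>\<^bsub>R\<^esub> q = p + q" "p \<otimes>\<^bsub>R\<^esub> q = p * q" "\<one>\<^bsub>R\<^esub> = 1" "\<zero>\<^bsub>R\<^esub> = 0"
  by (simp_all add: R_def)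

lemma module_jet_module:
  fixes c :: "(('u \<Rightarrow>\<^sub>0 nat) \<Rightarrow>\<^sub>0 int) \<Rightarrow> int"
  assumes c: "point_derivation c" and S: "stable S"
  shows "module R (jet_module c S)"
proof (rule moduleI)
  show "cring R" by (rule cring_R)
  show "abelian_group (jet_module c S)"
  proof (rule abelian_groupI)
    show "\<exists>y\<in>carrier (jet_module c S). y \<oplus>\<^bsub>jet_module c S\<^esub> x = \<zero>\<^bsub>jet_module c S\<^esub>"
      if "x \<in> carrier (jet_module c S)" for x
      using that stableD(3)[OF S] by (intro bexI[of _ "encode (- decode x)"]) auto
  qed (use stableD[OF S] in \<open>auto simp: algebra_simps\<close>)
  show "(p \<oplus>\<^bsub>R\<^esub> q) \<odot>\<^bsub>jet_module c S\<^esub> x =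
      p \<odot>\<^bsub>jet_module c S\<^esub> x \<oplus>\<^bsub>jet_module c S\<^esub> q \<odot>\<^bsub>jet_module c S\<^esub> x" for p q x
    using c by (simp add: point_derivation_def scale_def lookup_add algebra_simps)
  show "(p \<otimes>\<^bsub>R\<^esub> q) \<odot>\<^bsub>jet_module c S\<^esub> x =
      p \<odot>\<^bsub>jet_module c S\<^esub> (q \<odot>\<^bsub>jet_module c S\<^esub> x)" for p q x
    using c by (simp add: point_derivation_def scale_def lookup_mult_zero algebra_simps)
  show "\<one>\<^bsub>R\<^esub> \<odot>\<^bsub>jet_module c S\<^esub> x = x" if "x \<in> carrier (jet_module c S)" for x
    using that point_derivation_one[OF c] by (auto simp: scale_def)
qed (use stableD[OF S] in \<open>auto simp: scale_add\<close>)

lemma jet_module_minus [simp]: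
  fixes c :: "(('u \<Rightarrow>\<^sub>0 nat) \<Rightarrow>\<^sub>0 int) \<Rightarrow> int"
  assumes "point_derivation c" "stable S" "v \<in> S"
  shows "\<ominus>\<^bsub>jet_module c S\<^esub> encode v = encode (- v)"
proof -
  interpret module R "jet_module c S" using module_jet_module assms by blast
  show ?thesis by (rule minus_equality) (use assms stableD(3)[OF assms(2)] in auto)
qed

lemma jet_module_homs:
  assumes S: "stable S"
    and cl: "\<And>v. v \<in> S \<Longrightarrow> g v \<in> S'"
    and add: "\<And>v w. v \<in> S \<Longrightarrow> w \<in> S \<Longrightarrow> g (v + w) = g v + g w"
    and sc: "\<And>p v. v \<in> S \<Longrightarrow> g (scale c p v) = scale c' p (g v)"
  shows "(\<lambda>x\<in>encode ` S. encode (g (decode x))) \<in> module_homs R (jet_module c S) (jet_module c' S')"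
  unfolding module_homs_def jet_module_simps
proof (intro CollectI conjI ballI)
  show "(\<lambda>x\<in>encode ` S. encode (g (decode x))) \<in> encode ` S \<rightarrow>\<^sub>E encode ` S'"
    using cl by auto
  fix x assume "x \<in> encode ` S"
  then obtain v where x: "x = encode v" and v: "v \<in> S" by blast
  show "(\<lambda>x\<in>encode ` S. encode (g (decode x))) (encode (scale c p (decode x))) =
      encode (scale c' p (decode ((\<lambda>x\<in>encode ` S. encode (g (decode x))) x)))" for p
    using v x stableD(4)[OF S v, of c p] sc[OF v] by simp
  fix y assume "y \<in> encode ` S"
  then obtain w where y: "y = encode w" and w: "w \<in> S" by blast
  show "(\<lambda>x\<in>encode ` S. encode (g (decode x))) (encode (decode x + decode y)) =
      encode (decode ((\<lambda>x\<in>encode ` S. encode (g (decode x))) x) + decode ((\<lambda>x\<in>encode ` S. encode (g (decode x))) y))"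
    using v w x y stableD(2)[OF S v w] add[OF v w] by simp
qed

text \<open>The differential of a complex whose terms are among \<open>0\<close>, \<open>\<int>\<epsilon>\<close> and \<open>\<int>[\<epsilon>]\<close>. It is multiplication by
  \<open>\<epsilon>\<close> where this is possible, and zero at the point where the complex is cut off. A complex with terms
  \<open>\<int>\<epsilon>\<close> or \<open>0\<close> gets the zero differential, since \<open>\<epsilon>\<^sup>2 = 0\<close>.\<close>

definition jet_bd :: "(int \<Rightarrow> (int \<times> int) set) \<Rightarrow> int \<Rightarrow> int \<times> int \<Rightarrow> int \<times> int" where
  "jet_bd S n v = (if eps ` S n \<subseteq> S (n - 1) then eps v else 0)"

definition jet_complex where
  "jet_complex c S =
     \<lparr>deg = (\<lambda>n. jet_module c (S n)), bd = (\<lambda>n. \<lambda>x\<in>encode ` S n. encode (jet_bd S n (decode x)))\<rparr>"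

lemma jet_complex_simps [simp]:
  "deg (jet_complex c S) n = jet_module c (S n)"
  "v \<in> S n \<Longrightarrow> bd (jet_complex c S) n (encode v) = encode (jet_bd S n v)"
  by (simp_all add: jet_complex_def)

lemma jet_complex_in_K:
  assumes c: "point_derivation c" and S: "\<And>n. stable (S n)"
  shows "jet_complex c S \<in> obj K"
proof -
  have cl: "jet_bd S n v \<in> S (n - 1)" if "v \<in> S n" for n v
    using stableD(1)[OF S] that by (auto simp: jet_bd_def)
  have "is_chain_complex R (jet_complex c S)"
    unfolding is_chain_complex_def
  proof (intro conjI allI ballI)
    show "module R (deg (jet_complex c S) n)" for n using module_jet_module[OF c S] by simp
    show "bd (jet_complex c S) n \<in> module_homs R (deg (jet_complex c S) n) (deg (jet_complex c S) (n - 1))" for n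
      unfolding jet_complex_simps
      by (simp only: jet_complex_def chain_complex.select_convs, rule jet_module_homs[OF S cl])
        (auto simp: jet_bd_def eps_scale)
    show "bd (jet_complex c S) (n - 1) (bd (jet_complex c S) n x) = \<zero>\<^bsub>deg (jet_complex c S) (n - 2)\<^esub>"
      if "x \<in> carrier (deg (jet_complex c S) n)" for n x
    proof -
      from that obtain v where v: "x = encode v" "v \<in> S n" by (simp, blast)
      then show ?thesis using cl[OF v(2)] by (simp add: jet_bd_def)
    qed
  qed
  then show ?thesis using small_code by (simp add: K_def)
qed

definition jet_map :: "(int \<Rightarrow> (int \<times> int) set) \<Rightarrow> (int \<Rightarrow> int \<times> int \<Rightarrow> int \<times> int) \<Rightarrow> int \<Rightarrow> 'u \<Rightarrow> 'u" where
  "jet_map S g n = (\<lambda>x\<in>encode ` S n. encode (g n (decode x)))"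

lemma jet_map_code [simp]: "v \<in> S n \<Longrightarrow> jet_map S g n (encode v) = encode (g n v)"
  by (simp add: jet_map_def)

lemma jet_map_chain_map:
  assumes S: "\<And>n. stable (S n)"
    and "\<And>n v. v \<in> S n \<Longrightarrow> g n v \<in> S' n"
    and "\<And>n v w. v \<in> S n \<Longrightarrow> w \<in> S n \<Longrightarrow> g n (v + w) = g n v + g n w"
    and "\<And>n p v. v \<in> S n \<Longrightarrow> g n (scale c p v) = scale c' p (g n v)"
    and "\<And>n v. v \<in> S n \<Longrightarrow> g (n - 1) (jet_bd S n v) = jet_bd S' n (g n v)"
  shows "jet_map S g \<in> chain_maps R (jet_complex c S) (jet_complex c' S')"
proof -
  have cl: "jet_bd S n v \<in> S (n - 1)" if "v \<in> S n" for n v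
    using stableD(1)[OF S] that by (auto simp: jet_bd_def)
  show ?thesis
    unfolding chain_maps_def
  proof (intro CollectI conjI allI ballI)
    show "jet_map S g n \<in> module_homs R (deg (jet_complex c S) n) (deg (jet_complex c' S') n)" for n
      unfolding jet_map_def jet_complex_simps by (rule jet_module_homs[OF S]) (use assms(2-4) in blast)+
    fix n x assume "x \<in> carrier (deg (jet_complex c S) n)"
    then obtain v where x: "x = encode v" and v: "v \<in> S n" by auto
    show "jet_map S g (n - 1) (bd (jet_complex c S) n x) = bd (jet_complex c' S') n (jet_map S g n x)"
      using x v cl[OF v] assms(2,5)[OF v] by simp
  qed
qed

section \<open>Mapping cones\<close>

lemma direct_sum_simps [simp]:
  "pair x y \<in> carrier (direct_sum M N) \<longleftrightarrow> x \<in> carrier M \<and> y \<in> carrier N"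
  "\<zero>\<^bsub>direct_sum M N\<^esub> = pair \<zero>\<^bsub>M\<^esub> \<zero>\<^bsub>N\<^esub>"
  "pair x y \<oplus>\<^bsub>direct_sum M N\<^esub> pair x' y' = pair (x \<oplus>\<^bsub>M\<^esub> x') (y \<oplus>\<^bsub>N\<^esub> y')"
  "r \<odot>\<^bsub>direct_sum M N\<^esub> pair x y = pair (r \<odot>\<^bsub>M\<^esub> x) (r \<odot>\<^bsub>N\<^esub> y)"
  by (auto simp: direct_sum_def pair_eq_iff)

lemma direct_sum_cases:
  assumes "p \<in> carrier (direct_sum M N)"
  obtains x y where "p = pair x y" "x \<in> carrier M" "y \<in> carrier N"
  using assms by (auto simp: direct_sum_def)

lemma module_direct_sum:
  assumes "module L M" "module L N"
  shows "module L (direct_sum M N)"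
proof -
  interpret M: module L M by fact
  interpret N: module L N by fact
  show ?thesis
  proof (rule moduleI)
    show "cring L" ..
    show "abelian_group (direct_sum M N)"
    proof (rule abelian_groupI)
      show "\<exists>q\<in>carrier (direct_sum M N). q \<oplus>\<^bsub>direct_sum M N\<^esub> p = \<zero>\<^bsub>direct_sum M N\<^esub>"
        if "p \<in> carrier (direct_sum M N)" for p
        using that
      proof (rule direct_sum_cases)
        fix x y assume "p = pair x y" "x \<in> carrier M" "y \<in> carrier N"
        then show ?thesis
          by (intro bexI[of _ "pair (\<ominus>\<^bsub>M\<^esub> x) (\<ominus>\<^bsub>N\<^esub> y)"]) (auto simp: M.l_neg N.l_neg)
      qed
    qed (auto elim!: direct_sum_cases simp: M.add.m_ac N.add.m_ac)
  qed (auto elim!: direct_sum_cases simp: M.smult_l_distr N.smult_l_distr M.smult_r_distr N.smult_r_distr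
      M.smult_assoc1 N.smult_assoc1)
qed

lemma mapping_cone_deg [simp]:
  "deg (mapping_cone X Y f) n = direct_sum (deg X (n - 1)) (deg Y n)"
  by (simp add: mapping_cone_def)

lemma mapping_cone_bd:
  "x \<in> carrier (deg X (n - 1)) \<Longrightarrow> y \<in> carrier (deg Y n) \<Longrightarrow>
    bd (mapping_cone X Y f) n (pair x y) =
      pair (\<ominus>\<^bsub>deg X (n - 2)\<^esub> bd X (n - 1) x) (f (n - 1) x \<oplus>\<^bsub>deg Y (n - 1)\<^esub> bd Y n y)"
  by (simp add: mapping_cone_def)

lemma mapping_cone_complex:
  assumes X: "is_chain_complex L X" and Y: "is_chain_complex L Y" and f: "f \<in> chain_maps L X Y"
  shows "is_chain_complex L (mapping_cone X Y f)"
  unfolding is_chain_complex_def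
proof (intro conjI allI ballI)
  fix n
  show "module L (deg (mapping_cone X Y f) n)"
    using module_direct_sum[OF complex_module[OF X] complex_module[OF Y]] by simp
  interpret X1: module L "deg X (n - 1)" using complex_module[OF X] .
  interpret X2: module L "deg X (n - 2)" using complex_module[OF X] .
  interpret X3: module L "deg X (n - 3)" using complex_module[OF X] .
  interpret Y0: module L "deg Y n" using complex_module[OF Y] .
  interpret Y1: module L "deg Y (n - 1)" using complex_module[OF Y] .
  interpret Y2: module L "deg Y (n - 2)" using complex_module[OF Y] .
  have dX: "bd X (n - 1) \<in> module_homs L (deg X (n - 1)) (deg X (n - 2))"
    using complex_bd[OF X, of "n - 1"] by simp
  have dX': "bd X (n - 2) \<in> module_homs L (deg X (n - 2)) (deg X (n - 3))"
    using complex_bd[OF X, of "n - 2"] by simp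
  note dY = complex_bd[OF Y, of n]
  have dY': "bd Y (n - 1) \<in> module_homs L (deg Y (n - 1)) (deg Y (n - 2))"
    using complex_bd[OF Y, of "n - 1"] by simp
  note f1 = chain_maps_hom[OF f, of "n - 1"] and f2 = chain_maps_hom[OF f, of "n - 2"]
  note cl = module_homs_closed[OF dX] module_homs_closed[OF dX'] module_homs_closed[OF dY]
    module_homs_closed[OF dY'] module_homs_closed[OF f1] module_homs_closed[OF f2]
  have bdE: "bd (mapping_cone X Y f) n \<in> extensional (carrier (direct_sum (deg X (n - 1)) (deg Y n)))"
    by (simp add: mapping_cone_def)
  show "bd (mapping_cone X Y f) n \<in> module_homs L (deg (mapping_cone X Y f) n) (deg (mapping_cone X Y f) (n - 1))"
    unfolding module_homs_def mapping_cone_deg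
  proof (intro CollectI conjI ballI)
    show "bd (mapping_cone X Y f) n
      \<in> carrier (direct_sum (deg X (n - 1)) (deg Y n)) \<rightarrow>\<^sub>E carrier (direct_sum (deg X (n - 1 - 1)) (deg Y (n - 1)))"
      unfolding PiE_def using bdE
      by (auto elim!: direct_sum_cases simp: mapping_cone_bd cl)
  next
    fix p q
    assume "p \<in> carrier (direct_sum (deg X (n - 1)) (deg Y n))" "q \<in> carrier (direct_sum (deg X (n - 1)) (deg Y n))"
    then show "bd (mapping_cone X Y f) n (p \<oplus>\<^bsub>direct_sum (deg X (n - 1)) (deg Y n)\<^esub> q) =
       bd (mapping_cone X Y f) n p \<oplus>\<^bsub>direct_sum (deg X (n - 1 - 1)) (deg Y (n - 1))\<^esub> bd (mapping_cone X Y f) n q"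
      by (auto elim!: direct_sum_cases simp: mapping_cone_bd cl module_homs_add[OF dX] module_homs_add[OF dY]
          module_homs_add[OF f1] X2.minus_add Y1.add.m_ac)
  next
    fix r p
    assume "r \<in> carrier L" "p \<in> carrier (direct_sum (deg X (n - 1)) (deg Y n))"
    then show "bd (mapping_cone X Y f) n (r \<odot>\<^bsub>direct_sum (deg X (n - 1)) (deg Y n)\<^esub> p) =
       r \<odot>\<^bsub>direct_sum (deg X (n - 1 - 1)) (deg Y (n - 1))\<^esub> bd (mapping_cone X Y f) n p"
      by (auto elim!: direct_sum_cases simp: mapping_cone_bd cl module_homs_smult[OF dX] module_homs_smult[OF dY]
          module_homs_smult[OF f1] X2.smult_r_minus Y1.smult_r_distr)
  qed
  fix p assume "p \<in> carrier (deg (mapping_cone X Y f) n)"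
  then obtain x y where p: "p = pair x y" and x: "x \<in> carrier (deg X (n - 1))" and y: "y \<in> carrier (deg Y n)"
    by (auto elim: direct_sum_cases)
  have zX: "bd X (n - 2) (bd X (n - 1) x) = \<zero>\<^bsub>deg X (n - 3)\<^esub>"
    using complex_bd_bd[OF X x] by simp
  have cf: "f (n - 2) (bd X (n - 1) x) = bd Y (n - 1) (f (n - 1) x)"
    using chain_maps_bd[OF f x] by simp
  have "bd X (n - 2) (\<ominus>\<^bsub>deg X (n - 2)\<^esub> bd X (n - 1) x) = \<ominus>\<^bsub>deg X (n - 3)\<^esub> bd X (n - 2) (bd X (n - 1) x)"
    using module_homs_neg[OF dX' complex_module[OF X] complex_module[OF X]] cl x by simp
  moreover have "f (n - 2) (\<ominus>\<^bsub>deg X (n - 2)\<^esub> bd X (n - 1) x) = \<ominus>\<^bsub>deg Y (n - 2)\<^esub> f (n - 2) (bd X (n - 1) x)"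
    using module_homs_neg[OF f2 complex_module[OF X] complex_module[OF Y]] cl x by simp
  ultimately show "bd (mapping_cone X Y f) (n - 1) (bd (mapping_cone X Y f) n p) = \<zero>\<^bsub>deg (mapping_cone X Y f) (n - 2)\<^esub>"
    using mapping_cone_bd[of "\<ominus>\<^bsub>deg X (n - 2)\<^esub> bd X (n - 1) x" X "n - 1" "f (n - 1) x \<oplus>\<^bsub>deg Y (n - 1)\<^esub> bd Y n y" Y f]
      p x y cl zX cf complex_bd_bd[OF Y y]
    by (simp add: mapping_cone_bd module_homs_add[OF dY'] Y2.l_neg)
qed

text \<open>Boundaries are cycles, so acyclicity is the other inclusion. Here it is written out for the two
  components of an element of the cone, without mention of pairs.\<close>

lemma acyclic_mapping_cone_iff:
  assumes X: "is_chain_complex L X" and Y: "is_chain_complex L Y" and f: "f \<in> chain_maps L X Y"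
  shows "acyclic_complex (mapping_cone X Y f) \<longleftrightarrow>
    (\<forall>n. \<forall>x\<in>carrier (deg X (n - 1)). \<forall>y\<in>carrier (deg Y n).
       bd X (n - 1) x = \<zero>\<^bsub>deg X (n - 2)\<^esub> \<and> f (n - 1) x \<oplus>\<^bsub>deg Y (n - 1)\<^esub> bd Y n y = \<zero>\<^bsub>deg Y (n - 1)\<^esub> \<longrightarrow>
       (\<exists>x'\<in>carrier (deg X n). \<exists>y'\<in>carrier (deg Y (n + 1)).
          \<ominus>\<^bsub>deg X (n - 1)\<^esub> bd X n x' = x \<and> f n x' \<oplus>\<^bsub>deg Y n\<^esub> bd Y (n + 1) y' = y))"
    (is "_ \<longleftrightarrow> (\<forall>n. ?exact n)")
proof -
  let ?C = "mapping_cone X Y f"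
  note C = mapping_cone_complex[OF X Y f]
  have "{p \<in> carrier (deg ?C n). bd ?C n p = \<zero>\<^bsub>deg ?C (n - 1)\<^esub>} = bd ?C (n + 1) ` carrier (deg ?C (n + 1)) \<longleftrightarrow> ?exact n" for n
  proof -
    interpret X1: module L "deg X (n - 1)" using complex_module[OF X] .
    interpret X2: module L "deg X (n - 2)" using complex_module[OF X] .
    have bd_mem: "bd X (n - 1) x \<in> carrier (deg X (n - 2))" if "x \<in> carrier (deg X (n - 1))" for x
      using module_homs_closed[OF complex_bd[OF X, of "n - 1"] that] by simp
    have neg0: "\<ominus>\<^bsub>deg X (n - 2)\<^esub> u = \<zero>\<^bsub>deg X (n - 2)\<^esub> \<longleftrightarrow> u = \<zero>\<^bsub>deg X (n - 2)\<^esub>" if "u \<in> carrier (deg X (n - 2))" for u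
      using X2.add.inv_eq_1_iff[OF that] .
    have cyc: "pair x y \<in> {p \<in> carrier (deg ?C n). bd ?C n p = \<zero>\<^bsub>deg ?C (n - 1)\<^esub>} \<longleftrightarrow>
        x \<in> carrier (deg X (n - 1)) \<and> y \<in> carrier (deg Y n) \<and> bd X (n - 1) x = \<zero>\<^bsub>deg X (n - 2)\<^esub> \<and>
        f (n - 1) x \<oplus>\<^bsub>deg Y (n - 1)\<^esub> bd Y n y = \<zero>\<^bsub>deg Y (n - 1)\<^esub>" for x y
      using neg0[OF bd_mem] by (auto simp: mapping_cone_bd pair_eq_iff)
    have bdry: "pair x y \<in> bd ?C (n + 1) ` carrier (deg ?C (n + 1)) \<longleftrightarrow>
        (\<exists>x'\<in>carrier (deg X n). \<exists>y'\<in>carrier (deg Y (n + 1)).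
          \<ominus>\<^bsub>deg X (n - 1)\<^esub> bd X n x' = x \<and> f n x' \<oplus>\<^bsub>deg Y n\<^esub> bd Y (n + 1) y' = y)" for x y
    proof -
      have e: "bd ?C (n + 1) (pair x' y') = pair (\<ominus>\<^bsub>deg X (n - 1)\<^esub> bd X n x') (f n x' \<oplus>\<^bsub>deg Y n\<^esub> bd Y (n + 1) y')"
        if "x' \<in> carrier (deg X n)" "y' \<in> carrier (deg Y (n + 1))" for x' y'
        using mapping_cone_bd[of x' X "n + 1" y' Y f] that by simp
      show ?thesis
      proof
        assume "pair x y \<in> bd ?C (n + 1) ` carrier (deg ?C (n + 1))"
        then obtain x' y' where "pair x y = bd ?C (n + 1) (pair x' y')" "x' \<in> carrier (deg X n)" "y' \<in> carrier (deg Y (n + 1))"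
          by (auto elim!: direct_sum_cases)
        then show "\<exists>x'\<in>carrier (deg X n). \<exists>y'\<in>carrier (deg Y (n + 1)).
          \<ominus>\<^bsub>deg X (n - 1)\<^esub> bd X n x' = x \<and> f n x' \<oplus>\<^bsub>deg Y n\<^esub> bd Y (n + 1) y' = y"
          using e by (auto simp: pair_eq_iff)
      next
        assume "\<exists>x'\<in>carrier (deg X n). \<exists>y'\<in>carrier (deg Y (n + 1)).
          \<ominus>\<^bsub>deg X (n - 1)\<^esub> bd X n x' = x \<and> f n x' \<oplus>\<^bsub>deg Y n\<^esub> bd Y (n + 1) y' = y"
        then obtain x' y' where "x' \<in> carrier (deg X n)" "y' \<in> carrier (deg Y (n + 1))"
          "\<ominus>\<^bsub>deg X (n - 1)\<^esub> bd X n x' = x" "f n x' \<oplus>\<^bsub>deg Y n\<^esub> bd Y (n + 1) y' = y" by blast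
        then show "pair x y \<in> bd ?C (n + 1) ` carrier (deg ?C (n + 1))"
          using e by (intro image_eqI[of _ _ "pair x' y'"]) auto
      qed
    qed
    have swap: "S = T \<longleftrightarrow> S \<subseteq> T" if "T \<subseteq> S" for S T :: "'u set" using that by blast
    have "bd ?C (n + 1) ` carrier (deg ?C (n + 1)) \<subseteq> {p \<in> carrier (deg ?C n). bd ?C n p = \<zero>\<^bsub>deg ?C (n - 1)\<^esub>}"
    proof (rule image_subsetI)
      fix q assume q: "q \<in> carrier (deg ?C (n + 1))"
      show "bd ?C (n + 1) q \<in> {p \<in> carrier (deg ?C n). bd ?C n p = \<zero>\<^bsub>deg ?C (n - 1)\<^esub>}"
        using module_homs_closed[OF complex_bd_up[OF C] q] complex_bd_bd[OF C q]
        by (simp only: mem_Collect_eq) simp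
    qed
    then have "{p \<in> carrier (deg ?C n). bd ?C n p = \<zero>\<^bsub>deg ?C (n - 1)\<^esub>} = bd ?C (n + 1) ` carrier (deg ?C (n + 1)) \<longleftrightarrow>
      {p \<in> carrier (deg ?C n). bd ?C n p = \<zero>\<^bsub>deg ?C (n - 1)\<^esub>} \<subseteq> bd ?C (n + 1) ` carrier (deg ?C (n + 1))"
      by (rule swap)
    also have "\<dots> \<longleftrightarrow> (\<forall>x y. pair x y \<in> {p \<in> carrier (deg ?C n). bd ?C n p = \<zero>\<^bsub>deg ?C (n - 1)\<^esub>} \<longrightarrow>
      pair x y \<in> bd ?C (n + 1) ` carrier (deg ?C (n + 1)))" (is "?A \<subseteq> ?B \<longleftrightarrow> _")
    proof
      assume r: "\<forall>x y. pair x y \<in> ?A \<longrightarrow> pair x y \<in> ?B"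
      show "?A \<subseteq> ?B"
      proof
        fix p assume p: "p \<in> ?A"
        then have "p \<in> carrier (direct_sum (deg X (n - 1)) (deg Y n))" by simp
        then obtain x y where "p = pair x y" by (rule direct_sum_cases)
        then show "p \<in> ?B" using r p by simp
      qed
    qed blast
    also have "\<dots> \<longleftrightarrow> ?exact n" unfolding cyc bdry by blast
    finally show ?thesis .
  qed
  then show ?thesis unfolding acyclic_complex_def by simp
qed

end

lemma adjunction_bij:
  assumes "adjunction C D F G \<phi>" "X \<in> obj C" "Y \<in> obj D"
  shows "bij_betw (\<phi> X Y) (homs D (on_obj F X) Y) (homs C X (on_obj G Y))"
  using conjunct1[OF assms(1)[unfolded adjunction_def], THEN bspec, OF assms(2), THEN bspec, OF assms(3)] .

lemma adjunction_natural:
  assumes "adjunction C D F G \<phi>" and X: "X \<in> obj C" "X' \<in> obj C" and Y: "Y \<in> obj D" "Y' \<in> obj D"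
    and h: "h \<in> homs C X' X" and k: "k \<in> homs D Y Y'" and a: "a \<in> homs D (on_obj F X) Y"
  shows "\<phi> X' Y' (cmp D (on_obj F X') (on_obj F X) Y'
                   (cmp D (on_obj F X) Y Y' k a) (on_hom F X' X h)) =
        cmp C X' X (on_obj G Y')
          (cmp C X (on_obj G Y) (on_obj G Y') (on_hom G Y Y' k) (\<phi> X Y a)) h"
  using conjunct2[OF assms(1)[unfolded adjunction_def], THEN bspec, OF X(1), THEN bspec, OF X(2),
      THEN bspec, OF Y(1), THEN bspec, OF Y(2), THEN bspec, OF h, THEN bspec, OF k, THEN bspec, OF a] .

context universe
begin

section \<open>The homotopy category\<close>

lemma obj_K_iff: "X \<in> obj K \<longleftrightarrow> is_chain_complex R X \<and> (\<forall>n. small (carrier (deg X n)))"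
  by (simp add: K_def)

lemma K_complex: "X \<in> obj K \<Longrightarrow> is_chain_complex R X"
  by (simp add: K_def)

abbreviation htpy_class where
  "htpy_class X Y f \<equiv> homotopy_rel R X Y `` {f}"

abbreviation chain_compose where
  "chain_compose X g f \<equiv> \<lambda>n. compose (carrier (deg X n)) (g n) (f n)"

lemma htpy_class_in_homs: "f \<in> chain_maps R X Y \<Longrightarrow> htpy_class X Y f \<in> homs K X Y"
  by (simp add: K_def quotientI)

lemma homs_K_cases:
  assumes "a \<in> homs K X Y"
  obtains f where "f \<in> chain_maps R X Y" "a = htpy_class X Y f"
  using assms by (auto simp: K_def elim: quotientE)

lemma htpy_class_eq_iff:
  assumes "X \<in> obj K" "Y \<in> obj K" "f \<in> chain_maps R X Y" "g \<in> chain_maps R X Y"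
  shows "htpy_class X Y f = htpy_class X Y g \<longleftrightarrow> (f, g) \<in> homotopy_rel R X Y"
  using eq_equiv_class_iff[OF homotopy_rel_equiv] assms K_complex by blast

lemma htpy_class_rep:
  assumes "X \<in> obj K" "Y \<in> obj K" "a \<in> homs K X Y" "f \<in> a"
  shows "f \<in> chain_maps R X Y" "a = htpy_class X Y f"
proof -
  obtain g where g: "g \<in> chain_maps R X Y" "a = htpy_class X Y g" using homs_K_cases[OF assms(3)] .
  then have "(g, f) \<in> homotopy_rel R X Y" using assms(4) by simp
  moreover from this show f: "f \<in> chain_maps R X Y" by (simp add: homotopy_rel_iff)
  ultimately show "a = htpy_class X Y f"
    using htpy_class_eq_iff[OF assms(1,2) g(1) f] g(2) by simp
qed

lemma cmp_htpy_class:
  assumes X: "X \<in> obj K" and Y: "Y \<in> obj K" and Z: "Z \<in> obj K"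
    and f: "f \<in> chain_maps R X Y" and g: "g \<in> chain_maps R Y Z"
  shows "cmp K X Y Z (htpy_class Y Z g) (htpy_class X Y f) = htpy_class X Z (chain_compose X g f)"
proof -
  have "htpy_class X Z (chain_compose X g' f') = htpy_class X Z (chain_compose X g f)"
    if "f' \<in> htpy_class X Y f" "g' \<in> htpy_class Y Z g" for f' g'
  proof -
    have rel: "(f, f') \<in> homotopy_rel R X Y" "(g, g') \<in> homotopy_rel R Y Z" using that by auto
    have "(chain_compose X g f, chain_compose X g' f') \<in> homotopy_rel R X Z"
      using homotopy_rel_compose[OF K_complex[OF X] K_complex[OF Y] K_complex[OF Z] rel] .
    then show ?thesis
      using equiv_class_eq[OF homotopy_rel_equiv[OF K_complex[OF X] K_complex[OF Z]]] by blast
  qed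
  moreover have "f \<in> htpy_class X Y f" "g \<in> htpy_class Y Z g"
    using equiv_class_self[OF homotopy_rel_equiv] K_complex X Y Z f g by blast+
  ultimately have "(\<Union>f'\<in>htpy_class X Y f. \<Union>g'\<in>htpy_class Y Z g. htpy_class X Z (chain_compose X g' f')) =
    htpy_class X Z (chain_compose X g f)" by blast
  then show ?thesis by (simp add: K_def)
qed

lemma cmp_in_homs:
  assumes "X \<in> obj K" "Y \<in> obj K" "Z \<in> obj K" "a \<in> homs K X Y" "b \<in> homs K Y Z"
  shows "cmp K X Y Z b a \<in> homs K X Z"
proof -
  obtain f where f: "f \<in> chain_maps R X Y" "a = htpy_class X Y f" using homs_K_cases[OF assms(4)] .
  obtain g where g: "g \<in> chain_maps R Y Z" "b = htpy_class Y Z g" using homs_K_cases[OF assms(5)] .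
  show ?thesis
    using cmp_htpy_class[OF assms(1-3) f(1) g(1)] f g
      htpy_class_in_homs[OF chain_maps_compose[OF K_complex[OF assms(1)] f(1) g(1)]] by simp
qed

lemma ide_K: "ide K X = htpy_class X X (\<lambda>n. \<lambda>x\<in>carrier (deg X n). x)"
  by (simp add: K_def)

lemma ide_in_homs: "X \<in> obj K \<Longrightarrow> ide K X \<in> homs K X X"
  unfolding ide_K by (intro htpy_class_in_homs chain_maps_id K_complex)

lemma cmp_ide_left:
  assumes "X \<in> obj K" "Y \<in> obj K" "a \<in> homs K X Y"
  shows "cmp K X Y Y (ide K Y) a = a"
proof -
  obtain f where f: "f \<in> chain_maps R X Y" "a = htpy_class X Y f" using homs_K_cases[OF assms(3)] .
  have "compose (carrier (deg X n)) (\<lambda>y\<in>carrier (deg Y n). y) (f n) = f n" for n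
    using chain_maps_hom[OF f(1), of n] by (intro Id_compose) (auto simp: module_homs_def PiE_def)
  then show ?thesis
    using cmp_htpy_class[OF assms(1,2,2) f(1) chain_maps_id[OF K_complex[OF assms(2)]]] f(2)
    by (simp add: ide_K)
qed

lemma cmp_ide_right:
  assumes "X \<in> obj K" "Y \<in> obj K" "a \<in> homs K X Y"
  shows "cmp K X X Y a (ide K X) = a"
proof -
  obtain f where f: "f \<in> chain_maps R X Y" "a = htpy_class X Y f" using homs_K_cases[OF assms(3)] .
  have "compose (carrier (deg X n)) (f n) (\<lambda>x\<in>carrier (deg X n). x) = f n" for n
    using chain_maps_hom[OF f(1), of n] by (intro compose_Id) (auto simp: module_homs_def PiE_def)
  then show ?thesis
    using cmp_htpy_class[OF assms(1,1,2) chain_maps_id[OF K_complex[OF assms(1)]] f(1)] f(2)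
    by (simp add: ide_K)
qed

text \<open>A chain map is a family of functions between small sets, indexed by the integers.\<close>

lemma set_sized_homs_K:
  assumes X: "X \<in> obj K" and Y: "Y \<in> obj K"
  shows "set_sized (homs K X Y)"
proof -
  have un: "set_sized (\<Union>n. carrier (deg Z n))" if "Z \<in> obj K" for Z
    using that by (intro small_imp_set_sized small_countable_Union) (auto simp: obj_K_iff)
  have "set_sized {f. \<forall>n. f n \<in> carrier (deg X n) \<rightarrow>\<^sub>E carrier (deg Y n)}"
    using un[OF X] un[OF Y] by (intro set_sized_families) auto
  moreover have "chain_maps R X Y \<subseteq> {f. \<forall>n. f n \<in> carrier (deg X n) \<rightarrow>\<^sub>E carrier (deg Y n)}"
    by (auto simp: chain_maps_def module_homs_def)
  ultimately have "set_sized (chain_maps R X Y)"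
    using set_sized_lepoll subset_imp_lepoll by blast
  moreover have "homs K X Y = (\<lambda>f. htpy_class X Y f) ` chain_maps R X Y"
    by (auto simp: K_def quotient_def)
  ultimately show ?thesis using set_sized_lepoll image_lepoll by metis
qed

section \<open>Adjoints of the inclusion of the acyclic complexes\<close>

lemma A_simps [simp]:
  "X \<in> obj A \<longleftrightarrow> X \<in> obj K \<and> acyclic_complex X" "homs A = homs K" "ide A = ide K" "cmp A = cmp K"
  by (simp_all add: A_def full_subcategory_def)

lemma inclusion_simps [simp]: "on_obj inclusion X = X" "on_hom inclusion X Y f = f"
  by (simp_all add: inclusion_def)

text \<open>Only the counit is needed: it is a morphism to \<open>Y\<close> from an acyclic complex through which every
  morphism to \<open>Y\<close> from an acyclic complex factors. The factor of \<open>a\<close> is the morphism that corresponds to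
  \<open>a\<close> under the adjunction.\<close>

lemma counit_of_right_adjoint:
  assumes "has_right_adjoint A K inclusion" and Y: "Y \<in> obj K"
  obtains W e where "W \<in> obj A" "e \<in> homs K W Y"
    "\<And>X a. X \<in> obj A \<Longrightarrow> a \<in> homs K X Y \<Longrightarrow> \<exists>b\<in>homs K X W. cmp K X W Y e b = a"
proof -
  obtain G \<phi> where G: "is_functor K A G" and adj: "adjunction A K inclusion G \<phi>"
    using assms(1) unfolding has_right_adjoint_def by blast
  have GA: "on_obj G Y \<in> obj A" using G Y unfolding is_functor_def by blast
  then have GK: "on_obj G Y \<in> obj K" by simp
  have Gide: "on_hom G Y Y (ide K Y) = ide K (on_obj G Y)"
    using G Y unfolding is_functor_def A_simps(2-) by blast
  have bij: "bij_betw (\<phi> X Y) (homs K X Y) (homs K X (on_obj G Y))" if "X \<in> obj A" for X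
    using adjunction_bij[OF adj that Y] by simp
  obtain e where e: "e \<in> homs K (on_obj G Y) Y" and pe: "\<phi> (on_obj G Y) Y e = ide K (on_obj G Y)"
    using ide_in_homs[OF GK] unfolding bij_betw_imp_surj_on[OF bij[OF GA], symmetric] by (rule imageE) simp
  have "\<exists>b\<in>homs K X (on_obj G Y). cmp K X (on_obj G Y) Y e b = a" if X: "X \<in> obj A" and a: "a \<in> homs K X Y" for X a
  proof (rule bexI)
    have XK: "X \<in> obj K" using X by simp
    show b: "\<phi> X Y a \<in> homs K X (on_obj G Y)" by (rule bij_betw_apply[OF bij[OF X] a])
    have eb: "cmp K X (on_obj G Y) Y e (\<phi> X Y a) \<in> homs K X Y"
      using cmp_in_homs[OF XK GK Y b e] .
    have nat: "\<phi> X Y (cmp K X (on_obj G Y) Y (cmp K (on_obj G Y) Y Y (ide K Y) e) (\<phi> X Y a)) =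
      cmp K X (on_obj G Y) (on_obj G Y)
        (cmp K (on_obj G Y) (on_obj G Y) (on_obj G Y) (on_hom G Y Y (ide K Y)) (\<phi> (on_obj G Y) Y e)) (\<phi> X Y a)"
      using adjunction_natural[OF adj GA X Y Y, of "\<phi> X Y a" "ide K Y" e] b e ide_in_homs[OF Y] by simp
    have "\<phi> X Y (cmp K X (on_obj G Y) Y e (\<phi> X Y a)) = \<phi> X Y a"
      using nat unfolding cmp_ide_left[OF GK Y e] Gide pe cmp_ide_left[OF GK GK ide_in_homs[OF GK]]
        cmp_ide_left[OF XK GK b] .
    then show "cmp K X (on_obj G Y) Y e (\<phi> X Y a) = a"
      by (rule inj_onD[OF bij_betw_imp_inj_on[OF bij[OF X]] _ eb a])
  qed
  then show ?thesis using that GA e by blast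
qed

text \<open>Dual to the previous lemma; the factor of \<open>a\<close> is now the inverse image of \<open>a\<close> under the adjunction.\<close>

lemma unit_of_left_adjoint:
  assumes "has_left_adjoint A K inclusion" and X: "X \<in> obj K"
  obtains W e where "W \<in> obj A" "e \<in> homs K X W"
    "\<And>Y a. Y \<in> obj A \<Longrightarrow> a \<in> homs K X Y \<Longrightarrow> \<exists>b\<in>homs K W Y. cmp K X W Y b e = a"
proof -
  obtain G \<phi> where G: "is_functor K A G" and adj: "adjunction K A G inclusion \<phi>"
    using assms(1) unfolding has_left_adjoint_def by blast
  have GA: "on_obj G X \<in> obj A" using G X unfolding is_functor_def by blast
  then have GK: "on_obj G X \<in> obj K" by simp
  have Gide: "on_hom G X X (ide K X) = ide K (on_obj G X)"
    using G X unfolding is_functor_def A_simps(2-) by blast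
  have bij: "bij_betw (\<phi> X Y) (homs K (on_obj G X) Y) (homs K X Y)" if "Y \<in> obj A" for Y
    using adjunction_bij[OF adj X that] by simp
  define e where "e = \<phi> X (on_obj G X) (ide K (on_obj G X))"
  have e: "e \<in> homs K X (on_obj G X)"
    unfolding e_def by (rule bij_betw_apply[OF bij[OF GA] ide_in_homs[OF GK]])
  have "\<exists>b\<in>homs K (on_obj G X) Y. cmp K X (on_obj G X) Y b e = a" if Y: "Y \<in> obj A" and a: "a \<in> homs K X Y" for Y a
  proof -
    have YK: "Y \<in> obj K" using Y by simp
    obtain b where b: "b \<in> homs K (on_obj G X) Y" and pb: "\<phi> X Y b = a"
      using a unfolding bij_betw_imp_surj_on[OF bij[OF Y], symmetric] by (rule imageE) simp
    have nat: "\<phi> X Y (cmp K (on_obj G X) (on_obj G X) Y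
        (cmp K (on_obj G X) (on_obj G X) Y b (ide K (on_obj G X))) (on_hom G X X (ide K X))) =
      cmp K X X Y (cmp K X (on_obj G X) Y b (\<phi> X (on_obj G X) (ide K (on_obj G X)))) (ide K X)"
      using adjunction_natural[OF adj X X GA Y, of "ide K X" b "ide K (on_obj G X)"] b ide_in_homs[OF X]
        ide_in_homs[OF GK] by simp
    have "a = cmp K X (on_obj G X) Y b e"
      using nat unfolding Gide cmp_ide_right[OF GK YK b] pb e_def[symmetric]
        cmp_ide_right[OF X YK cmp_in_homs[OF X GK YK e b]] .
    then show ?thesis using b by blast
  qed
  then show ?thesis using that GA e by blast
qed

section \<open>Dual numbers and trivial modules\<close>

definition var :: "'u \<Rightarrow> ('u \<Rightarrow>\<^sub>0 nat) \<Rightarrow>\<^sub>0 int" where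
  "var i = Poly_Mapping.single (Poly_Mapping.single i 1) 1"

lemma var_in_R: "ordinal elts i \<Longrightarrow> var i \<in> carrier R"
  by (simp add: var_def R_def)

lemma single_one_inject: "Poly_Mapping.single i (1::nat) = Poly_Mapping.single j 1 \<longleftrightarrow> i = j"
  by (metis lookup_single_eq lookup_single_not_eq one_neq_zero)

lemma scale_var:
  "scale (linear_coeff i) (var i) v = eps v"
  "i \<noteq> j \<Longrightarrow> scale (linear_coeff j) (var i) v = 0"
  "scale (\<lambda>p. 0) (var i) v = 0"
proof -
  have z: "Poly_Mapping.lookup (var i) 0 = 0"
    using single_one_nonzero[of i] by (simp add: var_def lookup_single when_def)
  have "linear_coeff j (var i) = (if i = j then 1 else 0)" for j
    unfolding var_def linear_coeff_def lookup_single single_one_inject by (simp add: when_def)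
  then show "scale (linear_coeff i) (var i) v = eps v"
    "i \<noteq> j \<Longrightarrow> scale (linear_coeff j) (var i) v = 0" "scale (\<lambda>p. 0) (var i) v = 0"
    using z by (simp_all add: scale_def eps_def zero_prod_def)
qed

text \<open>With all the integers for \<open>J\<close> this is the acyclic complex \<open>P\<^sub>i\<close>.\<close>

definition dual_complex :: "int set \<Rightarrow> 'u \<Rightarrow> (('u \<Rightarrow>\<^sub>0 nat) \<Rightarrow>\<^sub>0 int, 'u) chain_complex" where
  "dual_complex J i = jet_complex (linear_coeff i) (\<lambda>n. if n \<in> J then UNIV else {0})"

definition trivial_complex :: "int set \<Rightarrow> (('u \<Rightarrow>\<^sub>0 nat) \<Rightarrow>\<^sub>0 int, 'u) chain_complex" where
  "trivial_complex J = jet_complex (\<lambda>p. 0) (\<lambda>n. if n \<in> J then {0} \<times> UNIV else {0})"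

lemma dual_complex_in_K: "dual_complex J i \<in> obj K"
  unfolding dual_complex_def
  by (rule jet_complex_in_K[OF point_derivation_linear_coeff]) (simp add: stable_def)

lemma trivial_complex_in_K: "trivial_complex J \<in> obj K"
  unfolding trivial_complex_def
  by (rule jet_complex_in_K[OF point_derivation_zero]) (simp add: stable_def)

lemma carrier_dual_complex: "carrier (deg (dual_complex J i) n) = encode ` (if n \<in> J then UNIV else {0})"
  by (simp add: dual_complex_def)

lemma carrier_trivial_complex:
  "carrier (deg (trivial_complex J) n) = encode ` (if n \<in> J then {0} \<times> UNIV else {0})"
  by (simp add: trivial_complex_def)

lemma dual_complex_simps [simp]:
  "\<zero>\<^bsub>deg (dual_complex J i) n\<^esub> = encode 0"
  "p \<odot>\<^bsub>deg (dual_complex J i) n\<^esub> x = encode (scale (linear_coeff i) p (decode x))"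
  by (simp_all add: dual_complex_def)

lemma dual_complex_minus:
  assumes "encode v \<in> carrier (deg (dual_complex J i) n)"
  shows "\<ominus>\<^bsub>deg (dual_complex J i) n\<^esub> encode v = encode (- v)"
  using assms unfolding dual_complex_def jet_complex_simps jet_module_simps encode_mem_iff
  by (rule jet_module_minus[OF point_derivation_linear_coeff, rotated]) (simp add: stable_def)

lemma trivial_complex_simps [simp]:
  "\<zero>\<^bsub>deg (trivial_complex J) n\<^esub> = encode 0"
  "p \<odot>\<^bsub>deg (trivial_complex J) n\<^esub> x = encode (scale (\<lambda>p. 0) p (decode x))"
  "x \<oplus>\<^bsub>deg (trivial_complex J) n\<^esub> y = encode (decode x + decode y)"
  by (simp_all add: trivial_complex_def)

lemma bd_trivial_complex:
  assumes "x \<in> carrier (deg (trivial_complex J) n)"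
  shows "bd (trivial_complex J) n x = encode 0"
  using assms by (auto simp: trivial_complex_def jet_complex_def jet_bd_def eps_def zero_prod_def split: if_splits)

lemma bd_dual_complex:
  "n \<in> J \<Longrightarrow> n - 1 \<in> J \<Longrightarrow> bd (dual_complex J i) n (encode v) = encode (eps v)"
  "n \<in> J \<Longrightarrow> n - 1 \<notin> J \<Longrightarrow> bd (dual_complex J i) n (encode v) = encode 0"
proof -
  have "eps (1, 0) \<noteq> 0" by (simp add: zero_prod_def)
  then have ne: "\<not> range eps \<subseteq> {0}" by blast
  show "n \<in> J \<Longrightarrow> n - 1 \<in> J \<Longrightarrow> bd (dual_complex J i) n (encode v) = encode (eps v)"
    by (simp add: dual_complex_def jet_complex_def jet_bd_def)
  show "n \<in> J \<Longrightarrow> n - 1 \<notin> J \<Longrightarrow> bd (dual_complex J i) n (encode v) = encode 0"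
    using ne by (simp add: dual_complex_def jet_complex_def jet_bd_def)
qed

lemma eps_exact: "eps v = 0 \<Longrightarrow> \<exists>w. v = eps w"
  by (cases v) (auto simp: eps_def zero_prod_def)

lemma dual_complex_acyclic: "acyclic_complex (dual_complex UNIV i)"
proof -
  have "{x \<in> range encode. bd (dual_complex UNIV i) n x = encode 0} = bd (dual_complex UNIV i) (n + 1) ` range encode" for n
  proof (intro equalityI subsetI)
    fix x assume "x \<in> {x \<in> range encode. bd (dual_complex UNIV i) n x = encode 0}"
    then obtain v where x: "x = encode v" "bd (dual_complex UNIV i) n (encode v) = encode 0" by blast
    then have "eps v = 0" by (simp add: bd_dual_complex)
    then obtain w where "v = eps w" using eps_exact by blast
    then show "x \<in> bd (dual_complex UNIV i) (n + 1) ` range encode"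
      using x by (intro image_eqI[of _ _ "encode w"]) (auto simp: bd_dual_complex)
  next
    fix x assume "x \<in> bd (dual_complex UNIV i) (n + 1) ` range encode"
    then obtain w where "x = bd (dual_complex UNIV i) (n + 1) (encode w)" by blast
    then show "x \<in> {x \<in> range encode. bd (dual_complex UNIV i) n x = encode 0}"
      by (simp add: bd_dual_complex)
  qed
  then show ?thesis unfolding acyclic_complex_def carrier_dual_complex by simp
qed

lemma projection_chain_map:
  "jet_map (\<lambda>n. if n \<in> J then UNIV else {0}) (\<lambda>n v. if n \<in> I then eps v else 0)
     \<in> chain_maps R (dual_complex J i) (trivial_complex I)"
  unfolding dual_complex_def trivial_complex_def
proof (rule jet_map_chain_map)
  show "stable (if n \<in> J then UNIV else {0})" for n :: int by (simp add: stable_def)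
qed (auto simp: stable_def eps_def scale_def jet_bd_def zero_prod_def)

lemma inclusion_chain_map:
  "jet_map (\<lambda>n. {0} \<times> UNIV) (\<lambda>n v. v) \<in> chain_maps R (trivial_complex UNIV) (dual_complex UNIV i)"
proof -
  have "jet_map (\<lambda>n. {0} \<times> UNIV) (\<lambda>n v. v) \<in> chain_maps R (jet_complex (\<lambda>p. 0) (\<lambda>n. {0} \<times> UNIV)) (jet_complex (linear_coeff i) (\<lambda>n. UNIV))"
    by (rule jet_map_chain_map) (auto simp: stable_def eps_def scale_def jet_bd_def zero_prod_def)
  then show ?thesis by (simp add: dual_complex_def trivial_complex_def)
qed

text \<open>A homotopy \<open>h\<close> changes the value at \<open>x\<close> by \<open>d (h x) + h (d x)\<close>. The first summand vanishes since \<open>d = 0\<close>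
  in the target, and the second one since \<open>h (x\<^sub>i z) = x\<^sub>i h(z)\<close> and \<open>x\<^sub>i\<close> acts on the target as zero. The
  element \<open>x\<close> may well be a cycle: then \<open>z = 0\<close> will do.\<close>

lemma homotopic_to_trivial_eq:
  assumes X: "X \<in> obj K" and fg: "(f, g) \<in> homotopy_rel R X (trivial_complex J)"
    and x: "x \<in> carrier (deg X n)" and i: "ordinal elts i" and z: "z \<in> carrier (deg X (n - 1))"
    and bd: "bd X n x = var i \<odot>\<^bsub>deg X (n - 1)\<^esub> z"
  shows "f n x = g n x"
proof -
  let ?T = "trivial_complex J"
  have T: "is_chain_complex R ?T" using trivial_complex_in_K K_complex by blast
  interpret module R "deg ?T n" using complex_module[OF T] .
  obtain h where h: "homotopy R X ?T f g h" and f: "f \<in> chain_maps R X ?T" and g: "g \<in> chain_maps R X ?T"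
    using fg by (auto simp: homotopy_rel_iff)
  have "h (n - 1) \<in> module_homs R (deg X (n - 1)) (deg ?T (n - 1 + 1))"
    using h unfolding homotopy_def by blast
  then have hom: "h (n - 1) \<in> module_homs R (deg X (n - 1)) (deg ?T n)" by simp
  have "h (n - 1) (bd X n x) = var i \<odot>\<^bsub>deg ?T n\<^esub> h (n - 1) z"
    unfolding bd by (rule module_homs_smult[OF hom var_in_R[OF i] z])
  also have "\<dots> = \<zero>\<^bsub>deg ?T n\<^esub>" by (simp add: scale_var)
  finally have 1: "h (n - 1) (bd X n x) = \<zero>\<^bsub>deg ?T n\<^esub>" .
  have "bd ?T (n + 1) (h n x) = \<zero>\<^bsub>deg ?T n\<^esub>"
    using bd_trivial_complex homotopy_closed(1)[OF K_complex[OF X] T h x] by simp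
  then have "f n x = g n x \<oplus>\<^bsub>deg ?T n\<^esub> (\<zero>\<^bsub>deg ?T n\<^esub> \<oplus>\<^bsub>deg ?T n\<^esub> \<zero>\<^bsub>deg ?T n\<^esub>)"
    using h x 1 unfolding homotopy_def by simp
  then show ?thesis using module_homs_closed[OF chain_maps_hom[OF g] x] by (simp only: l_zero r_zero zero_closed)
qed

text \<open>Here \<open>h (d x) = 0\<close> because \<open>d = 0\<close> in the source, and \<open>d (h x) = x\<^sub>i h(x) = h (x\<^sub>i x) = 0\<close> because the
  differential of \<open>P\<^sub>i\<close> is the action of \<open>x\<^sub>i\<close>.\<close>

lemma homotopic_from_trivial_eq:
  assumes fg: "(f, g) \<in> homotopy_rel R (trivial_complex UNIV) (dual_complex UNIV i)"
    and i: "ordinal elts i" and x: "x \<in> carrier (deg (trivial_complex UNIV) n)"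
  shows "f n x = g n x"
proof -
  let ?T = "trivial_complex UNIV" and ?P = "dual_complex UNIV i"
  have T: "is_chain_complex R ?T" using trivial_complex_in_K K_complex by blast
  have P: "is_chain_complex R ?P" using dual_complex_in_K K_complex by blast
  interpret module R "deg ?P n" using complex_module[OF P] .
  obtain h where h: "homotopy R ?T ?P f g h" and g: "g \<in> chain_maps R ?T ?P"
    using fg by (auto simp: homotopy_rel_iff)
  have hom: "h m \<in> module_homs R (deg ?T m) (deg ?P (m + 1))" for m
    using h unfolding homotopy_def by blast
  have h0: "h m (encode 0) = encode 0" for m
    using module_homs_zero[OF hom complex_module[OF T] complex_module[OF P], of m] by simp
  have 1: "h (n - 1) (bd ?T n x) = \<zero>\<^bsub>deg ?P n\<^esub>"
    using bd_trivial_complex[OF x] h0 by simp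
  obtain v where v: "h n x = encode v"
    using homotopy_closed(1)[OF T P h x] by (auto simp: carrier_dual_complex)
  have "encode (eps v) = var i \<odot>\<^bsub>deg ?P (n + 1)\<^esub> h n x"
    using v by (simp add: scale_var)
  also have "\<dots> = h n (var i \<odot>\<^bsub>deg ?T n\<^esub> x)"
    using module_homs_smult[OF hom var_in_R[OF i] x] by simp
  also have "\<dots> = encode 0" by (simp add: scale_var h0)
  finally have "bd ?P (n + 1) (h n x) = \<zero>\<^bsub>deg ?P n\<^esub>"
    using v by (simp add: bd_dual_complex)
  then have "f n x = g n x \<oplus>\<^bsub>deg ?P n\<^esub> (\<zero>\<^bsub>deg ?P n\<^esub> \<oplus>\<^bsub>deg ?P n\<^esub> \<zero>\<^bsub>deg ?P n\<^esub>)"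
    using h x 1 unfolding homotopy_def by simp
  then show ?thesis using module_homs_closed[OF chain_maps_hom[OF g] x] by (simp only: l_zero r_zero zero_closed)
qed

section \<open>The inclusion has no adjoints\<close>

lemma ordinals_not_inj_small:
  assumes "inj_on f {i. ordinal elts i}" "f ` {i. ordinal elts i} \<subseteq> S" "small S"
  shows False
  using set_sized_inj_on[OF small_imp_set_sized[OF assms(3)] assms(1,2)] not_set_sized_ordinals by contradiction

text \<open>Let \<open>e : W \<rightarrow> T\<close> be the counit and \<open>g\<^sub>i : P\<^sub>i \<rightarrow> W\<close> the lift of the projection \<open>\<epsilon> : P\<^sub>i \<rightarrow> T\<close>. Let \<open>a\<^sub>i\<close>
  and \<open>b\<^sub>i\<close> be the images of the units of \<open>P\<^sub>i\<close> in degrees two and one, so that \<open>d a\<^sub>i = x\<^sub>i b\<^sub>i\<close>. If \<open>b\<^sub>i = b\<^sub>j\<close>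
  with \<open>i \<noteq> j\<close>, then \<open>d a\<^sub>i = x\<^sub>i b\<^sub>j = 0\<close>, so \<open>a\<^sub>i\<close> is a boundary and \<open>e a\<^sub>i = 0\<close>; but \<open>e a\<^sub>i = \<epsilon>\<close>. Thus \<open>b\<close>
  embeds the ordinals into the small module in degree one of \<open>W\<close>.\<close>

lemma inclusion_no_right_adjoint: "\<not> has_right_adjoint A K inclusion"
proof
  assume adj: "has_right_adjoint A K inclusion"
  let ?T = "trivial_complex UNIV"
  obtain W \<kappa> where W: "W \<in> obj A" and \<kappa>: "\<kappa> \<in> homs K W ?T"
    and lift: "\<And>X a. X \<in> obj A \<Longrightarrow> a \<in> homs K X ?T \<Longrightarrow> \<exists>b\<in>homs K X W. cmp K X W ?T \<kappa> b = a"
    using counit_of_right_adjoint[OF adj trivial_complex_in_K] by blast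
  have WK: "W \<in> obj K" and acy: "acyclic_complex W" using W by auto
  have TK: "?T \<in> obj K" by (rule trivial_complex_in_K)
  obtain e where e: "e \<in> chain_maps R W ?T" and \<kappa>e: "\<kappa> = htpy_class W ?T e" using homs_K_cases[OF \<kappa>] .
  have "\<exists>g. g \<in> chain_maps R (dual_complex UNIV i) W \<and> (\<forall>n v. e n (g n (encode v)) = encode (eps v))"
    if i: "ordinal elts i" for i
  proof -
    let ?P = "dual_complex UNIV i"
    have PK: "?P \<in> obj K" by (rule dual_complex_in_K)
    then have PA: "?P \<in> obj A" using dual_complex_acyclic by simp
    define q where "q = jet_map (\<lambda>n. UNIV) (\<lambda>n. eps)"
    have q: "q \<in> chain_maps R ?P ?T"
      using projection_chain_map[of UNIV UNIV i] by (simp add: q_def)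
    obtain b where b: "b \<in> homs K ?P W" "cmp K ?P W ?T \<kappa> b = htpy_class ?P ?T q"
      using lift[OF PA htpy_class_in_homs[OF q]] by blast
    obtain g where g: "g \<in> chain_maps R ?P W" "b = htpy_class ?P W g" using homs_K_cases[OF b(1)] .
    have "htpy_class ?P ?T (chain_compose ?P e g) = htpy_class ?P ?T q"
      using cmp_htpy_class[OF PK WK TK g(1) e] b(2) g(2) \<kappa>e by simp
    then have rel: "(chain_compose ?P e g, q) \<in> homotopy_rel R ?P ?T"
      using htpy_class_eq_iff[OF PK TK chain_maps_compose[OF K_complex[OF PK] g(1) e] q] by simp
    have "chain_compose ?P e g n (encode v) = q n (encode v)" for n v
      by (rule homotopic_to_trivial_eq[OF PK rel _ i, of _ _ "encode v"])
        (simp_all add: carrier_dual_complex bd_dual_complex scale_var)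
    then have "e n (g n (encode v)) = encode (eps v)" for n v
      by (simp add: q_def compose_eq carrier_dual_complex)
    then show ?thesis using g(1) by blast
  qed
  then obtain g where g: "\<And>i. ordinal elts i \<Longrightarrow> g i \<in> chain_maps R (dual_complex UNIV i) W"
    and eg: "\<And>i n v. ordinal elts i \<Longrightarrow> e n (g i n (encode v)) = encode (eps v)" by metis
  define b where "b i = g i 1 (encode (1, 0))" for i
  have bmem: "b i \<in> carrier (deg W 1)" if "ordinal elts i" for i
    using module_homs_closed[OF chain_maps_hom[OF g[OF that]]] by (simp add: b_def carrier_dual_complex)
  have sm: "g i 1 (var j \<odot>\<^bsub>deg (dual_complex UNIV i) 1\<^esub> encode (1, 0)) = var j \<odot>\<^bsub>deg W 1\<^esub> b i"
    if "ordinal elts i" "ordinal elts j" for i j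
    unfolding b_def
    by (rule module_homs_smult[OF chain_maps_hom[OF g[OF that(1)]] var_in_R[OF that(2)]])
      (simp add: carrier_dual_complex)
  have "i = j" if i: "ordinal elts i" and j: "ordinal elts j" and eq: "b i = b j" for i j
  proof (rule ccontr)
    assume ne: "i \<noteq> j"
    define a where "a = g i 2 (encode (1, 0))"
    have a: "a \<in> carrier (deg W 2)"
      using module_homs_closed[OF chain_maps_hom[OF g[OF i]]] by (simp add: a_def carrier_dual_complex)
    have "bd W 2 a = g i 1 (encode (eps (1, 0)))"
      using chain_maps_bd[OF g[OF i], of "encode (1, 0)" 2] by (simp add: a_def carrier_dual_complex bd_dual_complex)
    also have "\<dots> = var i \<odot>\<^bsub>deg W 1\<^esub> b j"
      using sm[OF i i] eq by (simp add: scale_var)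
    also have "\<dots> = g j 1 (encode 0)"
      using sm[OF j i] ne by (simp add: scale_var)
    also have "\<dots> = \<zero>\<^bsub>deg W 1\<^esub>"
      using module_homs_zero[OF chain_maps_hom[OF g[OF j]] complex_module[OF K_complex[OF dual_complex_in_K]]
          complex_module[OF K_complex[OF WK]], of 1] by simp
    finally have "bd W 2 a = \<zero>\<^bsub>deg W (2 - 1)\<^esub>" by simp
    then have "a \<in> bd W (2 + 1) ` carrier (deg W (2 + 1))"
      using acy a unfolding acyclic_complex_def by blast
    then obtain c where c: "c \<in> carrier (deg W 3)" "a = bd W 3 c" by auto
    have "e 2 a = bd ?T 3 (e 3 c)" using chain_maps_bd[OF e c(1)] c(2) by simp
    also have "\<dots> = encode 0" using bd_trivial_complex module_homs_closed[OF chain_maps_hom[OF e] c(1)] by blast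
    finally show False using eg[OF i, of 2 "(1, 0)"] by (simp add: a_def zero_prod_def)
  qed
  then have "inj_on b {i. ordinal elts i}" by (auto intro: inj_onI)
  moreover have "b ` {i. ordinal elts i} \<subseteq> carrier (deg W 1)" using bmem by blast
  moreover have "small (carrier (deg W 1))" using WK by (simp add: obj_K_iff)
  ultimately show False by (rule ordinals_not_inj_small)
qed

text \<open>Let \<open>e : T \<rightarrow> W\<close> be the unit of the adjunction. As \<open>W\<close> is acyclic, the image \<open>w\<close> of the generator of \<open>T\<close>
  in degree zero is \<open>d v\<close> for some \<open>v\<close>. The embedding of \<open>T\<close> into \<open>P\<^sub>i\<close> extends to \<open>g\<^sub>i : W \<rightarrow> P\<^sub>i\<close>, and then
  \<open>\<epsilon> g\<^sub>i(v) = g\<^sub>i(w) = \<epsilon>\<close>. So \<open>g\<^sub>i\<close> sends \<open>x\<^sub>i v\<close> to \<open>\<epsilon>\<close> and \<open>x\<^sub>j v\<close> to \<open>0\<close> if \<open>j \<noteq> i\<close>, and the elements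
  \<open>x\<^sub>i v\<close> are pairwise different.\<close>

lemma inclusion_no_left_adjoint: "\<not> has_left_adjoint A K inclusion"
proof
  assume adj: "has_left_adjoint A K inclusion"
  let ?T = "trivial_complex UNIV"
  obtain W \<eta> where W: "W \<in> obj A" and \<eta>: "\<eta> \<in> homs K ?T W"
    and ext: "\<And>Y a. Y \<in> obj A \<Longrightarrow> a \<in> homs K ?T Y \<Longrightarrow> \<exists>b\<in>homs K W Y. cmp K ?T W Y b \<eta> = a"
    using unit_of_left_adjoint[OF adj trivial_complex_in_K] by blast
  have WK: "W \<in> obj K" and acy: "acyclic_complex W" using W by auto
  have TK: "?T \<in> obj K" by (rule trivial_complex_in_K)
  interpret W: module R "deg W 1" using complex_module[OF K_complex[OF WK]] .
  obtain e where e: "e \<in> chain_maps R ?T W" and \<eta>e: "\<eta> = htpy_class ?T W e" using homs_K_cases[OF \<eta>] .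
  have one: "encode (0, 1) \<in> carrier (deg ?T n)" for n
    by (simp add: carrier_trivial_complex)
  define w where "w = e 0 (encode (0, 1))"
  have w: "w \<in> carrier (deg W 0)" using module_homs_closed[OF chain_maps_hom[OF e] one] by (simp add: w_def)
  have "bd W 0 w = e (0 - 1) (encode 0)"
    using chain_maps_bd[OF e one[of 0]] bd_trivial_complex[OF one[of 0]] by (simp add: w_def)
  also have "\<dots> = \<zero>\<^bsub>deg W (0 - 1)\<^esub>"
    using module_homs_zero[OF chain_maps_hom[OF e] complex_module[OF K_complex[OF TK]]
        complex_module[OF K_complex[OF WK]], of "0 - 1"] by simp
  finally have "w \<in> bd W (0 + 1) ` carrier (deg W (0 + 1))"
    using acy w unfolding acyclic_complex_def by blast
  then obtain v where v: "v \<in> carrier (deg W 1)" and bv: "bd W 1 v = w" by auto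
  have fac: "\<exists>g. g \<in> chain_maps R W (dual_complex UNIV i) \<and> g 0 w = encode (0, 1)"
    if i: "ordinal elts i" for i
  proof -
    let ?P = "dual_complex UNIV i"
    have PK: "?P \<in> obj K" by (rule dual_complex_in_K)
    then have PA: "?P \<in> obj A" using dual_complex_acyclic by simp
    define j where "j = jet_map (\<lambda>n. {0} \<times> UNIV) (\<lambda>n v. v)"
    have j: "j \<in> chain_maps R ?T ?P" using inclusion_chain_map by (simp add: j_def)
    obtain b where b: "b \<in> homs K W ?P" "cmp K ?T W ?P b \<eta> = htpy_class ?T ?P j"
      using ext[OF PA htpy_class_in_homs[OF j]] by blast
    obtain g where g: "g \<in> chain_maps R W ?P" "b = htpy_class W ?P g" using homs_K_cases[OF b(1)] .
    have "htpy_class ?T ?P (chain_compose ?T g e) = htpy_class ?T ?P j"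
      using cmp_htpy_class[OF TK WK PK e g(1)] b(2) g(2) \<eta>e by simp
    then have rel: "(chain_compose ?T g e, j) \<in> homotopy_rel R ?T ?P"
      using htpy_class_eq_iff[OF TK PK chain_maps_compose[OF K_complex[OF TK] e g(1)] j] by simp
    have "g 0 w = encode (0, 1)"
      using homotopic_from_trivial_eq[OF rel i one[of 0]] one[of 0] by (simp add: compose_eq w_def j_def zero_prod_def)
    then show ?thesis using g(1) by blast
  qed
  have "i = j" if i: "ordinal elts i" and j: "ordinal elts j"
    and eq: "var i \<odot>\<^bsub>deg W 1\<^esub> v = var j \<odot>\<^bsub>deg W 1\<^esub> v" for i j
  proof (rule ccontr)
    assume ne: "i \<noteq> j"
    obtain g where g: "g \<in> chain_maps R W (dual_complex UNIV i)" and gw: "g 0 w = encode (0, 1)"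
      using fac[OF i] by blast
    obtain p where p: "g 1 v = encode p"
      using module_homs_closed[OF chain_maps_hom[OF g] v] by (auto simp: carrier_dual_complex)
    have "encode (eps p) = encode (0, 1)"
      using chain_maps_bd[OF g v] gw bv p by (simp add: bd_dual_complex)
    moreover have "g 1 (var k \<odot>\<^bsub>deg W 1\<^esub> v) = encode (scale (linear_coeff i) (var k) p)" if "ordinal elts k" for k
      using module_homs_smult[OF chain_maps_hom[OF g] var_in_R[OF that] v] p by simp
    ultimately show False
      using eq i j ne by (metis encode_eq_iff scale_var(1,2) Pair_inject zero_prod_def zero_neq_one)
  qed
  then have "inj_on (\<lambda>i. var i \<odot>\<^bsub>deg W 1\<^esub> v) {i. ordinal elts i}" by (auto intro: inj_onI)
  moreover have "(\<lambda>i. var i \<odot>\<^bsub>deg W 1\<^esub> v) ` {i. ordinal elts i} \<subseteq> carrier (deg W 1)"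
    using var_in_R v by auto
  moreover have "small (carrier (deg W 1))" using WK by (simp add: obj_K_iff)
  ultimately show False by (rule ordinals_not_inj_small)
qed

section \<open>The derived category does not have small morphism sets\<close>

text \<open>This is the usual periodic resolution of \<open>\<int>\<close> over the dual numbers, with \<open>augmentation\<close> as its
  quasi-isomorphism to \<open>\<int>\<close> in degree zero. The degree one component of \<open>coclass\<close> is a cocycle for the class of
  the extension given by \<open>\<int>[\<epsilon>]\<close>.\<close>

definition resolution :: "'u \<Rightarrow> (('u \<Rightarrow>\<^sub>0 nat) \<Rightarrow>\<^sub>0 int, 'u) chain_complex" where
  "resolution i = dual_complex {0..} i"

definition augmentation where
  "augmentation = jet_map (\<lambda>n. if n \<in> {0..} then UNIV else {0}) (\<lambda>n v. if n \<in> {0} then eps v else 0)"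

text \<open>The vacuous condition gives this the shape of the chain maps in \<open>projection_chain_map\<close>.\<close>

definition coclass where
  "coclass = jet_map (\<lambda>n. if n \<in> {0..} then UNIV else {0}) (\<lambda>n v. if n \<in> UNIV then eps v else 0)"

lemma augmentation_chain_map: "augmentation \<in> chain_maps R (resolution i) (trivial_complex {0})"
  unfolding augmentation_def resolution_def by (rule projection_chain_map)

lemma coclass_chain_map: "coclass \<in> chain_maps R (resolution i) (trivial_complex UNIV)"
  unfolding coclass_def resolution_def by (rule projection_chain_map)

lemma resolution_in_K: "resolution i \<in> obj K"
  unfolding resolution_def by (rule dual_complex_in_K)

text \<open>In an element \<open>(x, y)\<close> of the cone, \<open>y\<close> vanishes outside degree zero. In degree zero \<open>x = 0\<close>, and \<open>y\<close> lifts
  along the augmentation. In a positive degree \<open>(x, 0)\<close> is a cycle only if \<open>\<epsilon> x = 0\<close>, and then \<open>x\<close> is a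
  multiple of \<open>\<epsilon>\<close>, thus a boundary.\<close>

lemma augmentation_cone: "mapping_cone (resolution i) (trivial_complex {0}) augmentation \<in> obj A"
proof -
  let ?E = "resolution i" and ?X = "trivial_complex {0}"
  have E: "is_chain_complex R ?E" using resolution_in_K K_complex by blast
  have X: "is_chain_complex R ?X" using trivial_complex_in_K K_complex by blast
  have "small (carrier (deg (mapping_cone ?E ?X augmentation) n))" for n
    unfolding mapping_cone_deg direct_sum_def partial_object.simps
    using resolution_in_K trivial_complex_in_K by (auto simp: obj_K_iff intro: small_pairs)
  then have K: "mapping_cone ?E ?X augmentation \<in> obj K"
    using mapping_cone_complex[OF E X augmentation_chain_map] by (simp add: obj_K_iff)
  have aug: "augmentation n (encode v) = encode (if n = 0 then eps v else 0)" if "n \<ge> 0" for n v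
    using that by (simp add: augmentation_def)
  have "acyclic_complex (mapping_cone ?E ?X augmentation)"
    unfolding acyclic_mapping_cone_iff[OF E X augmentation_chain_map]
  proof (intro allI ballI impI, elim conjE)
    fix n x y
    assume x: "x \<in> carrier (deg ?E (n - 1))" and y: "y \<in> carrier (deg ?X n)"
      and dx: "bd ?E (n - 1) x = \<zero>\<^bsub>deg ?E (n - 2)\<^esub>"
      and s: "augmentation (n - 1) x \<oplus>\<^bsub>deg ?X (n - 1)\<^esub> bd ?X n y = \<zero>\<^bsub>deg ?X (n - 1)\<^esub>"
    have o: "encode 0 \<in> carrier (deg ?X m)" for m by (simp add: carrier_trivial_complex zero_prod_def)
    obtain v where v: "x = encode v" "n < 1 \<Longrightarrow> v = 0"
      using x by (auto simp: resolution_def carrier_dual_complex split: if_splits)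
    obtain u where u: "y = encode u" "n \<noteq> 0 \<Longrightarrow> u = 0" "fst u = 0"
      using y by (auto simp: carrier_trivial_complex split: if_splits)
    have "\<exists>x'\<in>carrier (deg ?E n). \<ominus>\<^bsub>deg ?E (n - 1)\<^esub> bd ?E n x' = x \<and> augmentation n x' = y"
    proof -
      consider "n < 0" | "n = 0" | "n > 0" by linarith
      then show ?thesis
      proof cases
        case 1
        have "encode 0 \<in> carrier (deg ?E m)" for m by (simp add: resolution_def carrier_dual_complex)
        moreover have "bd ?E n (encode 0) = encode 0"
          using module_homs_zero[OF complex_bd[OF E] complex_module[OF E] complex_module[OF E], of n]
          by (simp add: resolution_def)
        moreover have "augmentation n (encode 0) = encode 0" using 1 by (simp add: augmentation_def)
        ultimately show ?thesis
          using v u 1 dual_complex_minus[of 0 "{0..}" i "n - 1"]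
          by (intro bexI[of _ "encode 0"]) (auto simp: resolution_def)
      next
        case 2
        have "bd ?E n (encode (snd u, 0)) = encode 0" using 2 by (simp add: resolution_def bd_dual_complex)
        moreover have "eps (snd u, 0) = u" using u(3) by (simp add: prod_eq_iff)
        ultimately show ?thesis
          using v u 2 dual_complex_minus[of 0 "{0..}" i "n - 1"] aug[of n "(snd u, 0)"]
          by (intro bexI[of _ "encode (snd u, 0)"]) (simp_all add: resolution_def carrier_dual_complex)
      next
        case 3
        have "eps v = 0"
        proof (cases "n = 1")
          case True
          then show ?thesis using s v aug[of 0 v] bd_trivial_complex[OF y] by simp
        next
          case False
          then show ?thesis using 3 dx v by (simp add: resolution_def bd_dual_complex)
        qed
        then obtain w where w: "v = eps w" using eps_exact by blast
        have "bd ?E n (encode (- w)) = encode (- v)" using 3 w by (simp add: resolution_def bd_dual_complex)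
        then show ?thesis
          using v u 3 dual_complex_minus[of "- v" "{0..}" i "n - 1"] aug[of n "- w"]
          by (intro bexI[of _ "encode (- w)"]) (simp_all add: resolution_def carrier_dual_complex)
      qed
    qed
    then obtain x' where x': "x' \<in> carrier (deg ?E n)" "\<ominus>\<^bsub>deg ?E (n - 1)\<^esub> bd ?E n x' = x" "augmentation n x' = y"
      by blast
    have "augmentation n x' \<oplus>\<^bsub>deg ?X n\<^esub> bd ?X (n + 1) (encode 0) = y"
      using x'(3) bd_trivial_complex[OF o] u by simp
    then show "\<exists>x'\<in>carrier (deg ?E n). \<exists>y'\<in>carrier (deg ?X (n + 1)).
        \<ominus>\<^bsub>deg ?E (n - 1)\<^esub> bd ?E n x' = x \<and> augmentation n x' \<oplus>\<^bsub>deg ?X n\<^esub> bd ?X (n + 1) y' = y"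
      using x'(1,2) o by blast
  qed
  then show ?thesis using K by simp
qed

definition ext_roof where
  "ext_roof i = (resolution i, htpy_class (resolution i) (trivial_complex {0}) augmentation,
     htpy_class (resolution i) (trivial_complex UNIV) coclass)"

abbreviation derived_rel where
  "derived_rel \<equiv> roof_rel K mor_A (trivial_complex {0}) (trivial_complex UNIV)"

lemma ext_roof_in_roofs: "ext_roof i \<in> roofs K mor_A (trivial_complex {0}) (trivial_complex UNIV)"
proof -
  have "augmentation \<in> htpy_class (resolution i) (trivial_complex {0}) augmentation"
    using equiv_class_self[OF homotopy_rel_equiv augmentation_chain_map] resolution_in_K
      trivial_complex_in_K K_complex by blast
  then show ?thesis
    unfolding roofs_def ext_roof_def mor_A_def
    using resolution_in_K augmentation_cone htpy_class_in_homs[OF augmentation_chain_map]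
      htpy_class_in_homs[OF coclass_chain_map] by blast
qed

text \<open>Since these roofs are related to themselves, an equality between two of their classes yields a pair of
  related roofs.\<close>

lemma ext_roof_refl: "(ext_roof i, ext_roof i) \<in> derived_rel"
proof -
  let ?E = "resolution i" and ?X = "trivial_complex {0}" and ?T = "trivial_complex UNIV"
  have "cmp K ?E ?E ?X (htpy_class ?E ?X augmentation) (ide K ?E) = htpy_class ?E ?X augmentation"
    "cmp K ?E ?E ?T (htpy_class ?E ?T coclass) (ide K ?E) = htpy_class ?E ?T coclass"
    by (rule cmp_ide_right; intro resolution_in_K trivial_complex_in_K htpy_class_in_homs
        augmentation_chain_map coclass_chain_map)+
  then show ?thesis
    using ext_roof_in_roofs[of i] ide_in_homs[OF resolution_in_K, of i]
    unfolding roof_rel_def ext_roof_def by blast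
qed

text \<open>Suppose that a roof \<open>X \<leftarrow> Z \<rightarrow> T\<close>, with left leg \<open>s\<close>, maps to both roofs by \<open>u\<close> and \<open>v\<close>. As \<open>s\<close> is a
  quasi-isomorphism, there is a cycle \<open>z\<close> of degree zero with \<open>s z = \<epsilon>\<close>. Since \<open>x\<^sub>i\<close> acts on \<open>X\<close> as zero,
  \<open>x\<^sub>i z\<close> is a boundary \<open>d y\<close>. Now the right leg of the common roof can be evaluated at \<open>y\<close> in two ways. Through
  \<open>u\<close> it is \<open>\<epsilon> u(y) = d (u y) = x\<^sub>i u(z) = \<epsilon> u(z)\<close>, which is \<open>s z = \<epsilon>\<close>. Through \<open>v\<close> it is
  \<open>\<epsilon> v(y) = x\<^sub>i v(z) = 0\<close>, since \<open>x\<^sub>i\<close> acts as zero on the resolution for \<open>j \<noteq> i\<close>.\<close>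

lemma ext_roof_inj:
  assumes i: "ordinal elts i" and j: "ordinal elts j" and rel: "(ext_roof i, ext_roof j) \<in> derived_rel"
  shows "i = j"
proof (rule ccontr)
  assume ne: "i \<noteq> j"
  let ?X = "trivial_complex {0}" and ?T = "trivial_complex UNIV" and ?E = "resolution i" and ?F = "resolution j"
  have XK: "?X \<in> obj K" and TK: "?T \<in> obj K" and EK: "?E \<in> obj K" and FK: "?F \<in> obj K"
    using resolution_in_K trivial_complex_in_K by auto
  obtain Z s u v where Z: "Z \<in> obj K" and s: "s \<in> mor_A Z ?X" and u: "u \<in> homs K Z ?E" and v: "v \<in> homs K Z ?F"
    and su: "cmp K Z ?E ?X (htpy_class ?E ?X augmentation) u = s"
    and fuv: "cmp K Z ?E ?T (htpy_class ?E ?T coclass) u = cmp K Z ?F ?T (htpy_class ?F ?T coclass) v"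
    using rel unfolding roof_rel_def ext_roof_def roofs_def by auto
  note ZC = K_complex[OF Z]
  obtain s0 where s0: "s0 \<in> s" and coneA: "mapping_cone Z ?X s0 \<in> obj A" and sh: "s \<in> homs K Z ?X"
    using s unfolding mor_A_def by blast
  have s0m: "s0 \<in> chain_maps R Z ?X" and s0c: "s = htpy_class Z ?X s0"
    using htpy_class_rep[OF Z XK sh s0] by auto
  obtain u0 where u0: "u0 \<in> chain_maps R Z ?E" "u = htpy_class Z ?E u0" using homs_K_cases[OF u] .
  obtain v0 where v0: "v0 \<in> chain_maps R Z ?F" "v = htpy_class Z ?F v0" using homs_K_cases[OF v] .
  have rel_s: "(chain_compose Z augmentation u0, s0) \<in> homotopy_rel R Z ?X"
    using su cmp_htpy_class[OF Z EK XK u0(1) augmentation_chain_map] u0(2) s0c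
      htpy_class_eq_iff[OF Z XK chain_maps_compose[OF ZC u0(1) augmentation_chain_map] s0m] by simp
  have rel_f: "(chain_compose Z coclass u0, chain_compose Z coclass v0) \<in> homotopy_rel R Z ?T"
    using fuv cmp_htpy_class[OF Z EK TK u0(1) coclass_chain_map] u0(2)
      cmp_htpy_class[OF Z FK TK v0(1) coclass_chain_map] v0(2)
      htpy_class_eq_iff[OF Z TK chain_maps_compose[OF ZC u0(1) coclass_chain_map]
        chain_maps_compose[OF ZC v0(1) coclass_chain_map]] by simp
  interpret Z0: module R "deg Z 0" using complex_module[OF ZC] .
  interpret Z1: module R "deg Z 1" using complex_module[OF ZC] .
  interpret Zm: module R "deg Z (- 1)" using complex_module[OF ZC] .
  have exact: "\<exists>x'\<in>carrier (deg Z n). \<exists>y'\<in>carrier (deg ?X (n + 1)).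
      \<ominus>\<^bsub>deg Z (n - 1)\<^esub> bd Z n x' = x \<and> s0 n x' \<oplus>\<^bsub>deg ?X n\<^esub> bd ?X (n + 1) y' = y"
    if "x \<in> carrier (deg Z (n - 1))" "y \<in> carrier (deg ?X n)" "bd Z (n - 1) x = \<zero>\<^bsub>deg Z (n - 2)\<^esub>"
      "s0 (n - 1) x \<oplus>\<^bsub>deg ?X (n - 1)\<^esub> bd ?X n y = \<zero>\<^bsub>deg ?X (n - 1)\<^esub>" for n x y
    using coneA that acyclic_mapping_cone_iff[OF ZC K_complex[OF XK] s0m] by auto
  have bdX: "bd ?X n y = encode 0" if "y \<in> carrier (deg ?X n)" for n y
    using bd_trivial_complex that .
  have zero: "g n \<zero>\<^bsub>deg Z n\<^esub> = \<zero>\<^bsub>deg Y n\<^esub>" if "g \<in> chain_maps R Z Y" "Y \<in> obj K" for g Y n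
    using module_homs_zero[OF chain_maps_hom[OF that(1)] complex_module[OF ZC] complex_module[OF K_complex[OF that(2)]]] .
  have bdz: "bd Z n \<zero>\<^bsub>deg Z n\<^esub> = \<zero>\<^bsub>deg Z (n - 1)\<^esub>" for n
    using module_homs_zero[OF complex_bd[OF ZC] complex_module[OF ZC] complex_module[OF ZC]] .
  have "encode (0, 1) \<in> carrier (deg ?X 0)" by (simp add: carrier_trivial_complex)
  then obtain z y' where z: "z \<in> carrier (deg Z 0)" and dz: "\<ominus>\<^bsub>deg Z (- 1)\<^esub> bd Z 0 z = \<zero>\<^bsub>deg Z (- 1)\<^esub>"
    and y': "y' \<in> carrier (deg ?X 1)" and sz: "s0 0 z \<oplus>\<^bsub>deg ?X 0\<^esub> bd ?X 1 y' = encode (0, 1)"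
    using exact[of "\<zero>\<^bsub>deg Z (- 1)\<^esub>" 0 "encode (0, 1)"] bdz[of "- 1"] bdX zero[OF s0m XK, of "- 1"] by auto
  have bz: "bd Z 0 z \<in> carrier (deg Z (- 1))" using module_homs_closed[OF complex_bd[OF ZC] z] by simp
  have dz: "bd Z 0 z = \<zero>\<^bsub>deg Z (- 1)\<^esub>" using dz Zm.add.inv_eq_1_iff[OF bz] by simp
  obtain t where "s0 0 z = encode t"
    using module_homs_closed[OF chain_maps_hom[OF s0m] z] by (auto simp: carrier_trivial_complex)
  then have sz: "s0 0 z = encode (0, 1)" using sz bdX[OF y'] by simp
  define x where "x = var i \<odot>\<^bsub>deg Z 0\<^esub> z"
  have x: "x \<in> carrier (deg Z 0)" unfolding x_def using var_in_R[OF i] z by simp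
  have dx: "bd Z 0 x = \<zero>\<^bsub>deg Z (- 1)\<^esub>"
    unfolding x_def using module_homs_smult[OF complex_bd[OF ZC] var_in_R[OF i] z] dz var_in_R[OF i] by simp
  have sx: "s0 0 x = encode 0"
    unfolding x_def using module_homs_smult[OF chain_maps_hom[OF s0m] var_in_R[OF i] z] by (simp add: scale_var)
  have "encode 0 \<in> carrier (deg ?X 1)" by (simp add: carrier_trivial_complex)
  then obtain y1 where y1: "y1 \<in> carrier (deg Z 1)" "\<ominus>\<^bsub>deg Z 0\<^esub> bd Z 1 y1 = x"
    using exact[of x 1 "encode 0"] x dx sx bdX by auto
  \<comment> \<open>The differential of the cone negates the differential of \<open>Z\<close>.\<close>
  define y where "y = \<ominus>\<^bsub>deg Z 1\<^esub> y1"
  have y: "y \<in> carrier (deg Z 1)" using y1 by (simp add: y_def)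
  have dy: "bd Z 1 y = var i \<odot>\<^bsub>deg Z 0\<^esub> z"
    using module_homs_neg[OF complex_bd[OF ZC] complex_module[OF ZC] complex_module[OF ZC] y1(1)] y1(2)
    by (simp add: y_def x_def)
  have val: "coclass n (encode w) = encode (eps w)" if "n \<ge> 0" for n w
    using that by (simp add: coclass_def)
  \<comment> \<open>\<open>u\<close> and \<open>v\<close> are treated alike: the parameter \<open>k\<close> will be \<open>i\<close> or \<open>j\<close>.\<close>
  have lift: "\<exists>p q. g 0 z = encode p \<and> g 1 y = encode q \<and> eps q = scale (linear_coeff k) (var i) p"
    if g: "g \<in> chain_maps R Z (resolution k)" for g k
  proof -
    obtain p where p: "g 0 z = encode p"
      using module_homs_closed[OF chain_maps_hom[OF g] z] by (auto simp: resolution_def carrier_dual_complex)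
    obtain q where q: "g 1 y = encode q"
      using module_homs_closed[OF chain_maps_hom[OF g] y] by (auto simp: resolution_def carrier_dual_complex)
    have "encode (eps q) = g 0 (bd Z 1 y)"
      using chain_maps_bd[OF g y] q by (simp add: resolution_def bd_dual_complex)
    also have "\<dots> = encode (scale (linear_coeff k) (var i) p)"
      unfolding dy using module_homs_smult[OF chain_maps_hom[OF g] var_in_R[OF i] z] p by (simp add: resolution_def)
    finally show ?thesis using p q by auto
  qed
  obtain p q where p: "u0 0 z = encode p" and q: "u0 1 y = encode q" "eps q = eps p"
    using lift[OF u0(1)] by (auto simp: scale_var)
  obtain q' where q': "v0 1 y = encode q'" "eps q' = 0"
    using lift[OF v0(1)] ne by (auto simp: scale_var)
  have "chain_compose Z augmentation u0 0 z = s0 0 z"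
    by (rule homotopic_to_trivial_eq[OF Z rel_s z i, of "\<zero>\<^bsub>deg Z (- 1)\<^esub>"]) (use dz var_in_R[OF i] in simp_all)
  then have "eps p = (0, 1)"
    using z p sz by (simp add: compose_eq augmentation_def)
  moreover have "chain_compose Z coclass u0 1 y = chain_compose Z coclass v0 1 y"
    by (rule homotopic_to_trivial_eq[OF Z rel_f y i]) (use dy z in simp_all)
  then have "eps q = eps q'" using y q(1) q'(1) by (simp add: compose_eq val)
  ultimately show False using q(2) q'(2) by (simp add: zero_prod_def)
qed

lemma D_simps: "obj D = obj K" "homs D X Y = roofs K mor_A X Y // roof_rel K mor_A X Y"
  by (simp_all add: D_def fractions_def)

lemma not_set_sized_homs_D: "\<not> set_sized (homs D (trivial_complex {0}) (trivial_complex UNIV))"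
proof
  assume sz: "set_sized (homs D (trivial_complex {0}) (trivial_complex UNIV))"
  have "inj_on (\<lambda>i. derived_rel `` {ext_roof i}) {i. ordinal elts i}"
  proof (rule inj_onI)
    fix i j assume ij: "i \<in> {i. ordinal elts i}" "j \<in> {i. ordinal elts i}"
      and eq: "derived_rel `` {ext_roof i} = derived_rel `` {ext_roof j}"
    have "ext_roof j \<in> derived_rel `` {ext_roof i}" using ext_roof_refl[of j] eq by blast
    then show "i = j" using ext_roof_inj ij by blast
  qed
  moreover have "(\<lambda>i. derived_rel `` {ext_roof i}) ` {i. ordinal elts i}
      \<subseteq> homs D (trivial_complex {0}) (trivial_complex UNIV)"
    unfolding D_simps using ext_roof_in_roofs by (auto intro: quotientI)
  ultimately have "set_sized {i. ordinal elts i}" using set_sized_inj_on[OF sz] by blast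
  then show False using not_set_sized_ordinals by contradiction
qed

lemma Q_on_obj [simp]: "on_obj Q X = X"
  by (simp add: Q_def fractions_functor_def)

lemma bij_betw_set_sized:
  assumes "bij_betw f S T" "set_sized T"
  shows "set_sized S"
  using assms set_sized_inj_on[of T f S] unfolding bij_betw_def by blast

lemma no_Bousfield_localization: "\<not> has_Bousfield_localization"
proof
  assume has_Bousfield_localization
  then obtain G \<phi> where G: "is_functor D K G" and adj: "adjunction K D Q G \<phi>"
    unfolding has_Bousfield_localization_def has_right_adjoint_def by blast
  let ?X = "trivial_complex {0}" and ?T = "trivial_complex UNIV"
  have "on_obj G ?T \<in> obj K"
    using G trivial_complex_in_K unfolding is_functor_def D_simps(1) by blast
  then have "set_sized (homs K ?X (on_obj G ?T))"
    using set_sized_homs_K trivial_complex_in_K by blast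
  moreover have "bij_betw (\<phi> ?X ?T) (homs D ?X ?T) (homs K ?X (on_obj G ?T))"
    using adjunction_bij[OF adj, of ?X ?T] trivial_complex_in_K by (simp add: D_simps(1))
  ultimately show False using bij_betw_set_sized not_set_sized_homs_D by blast
qed

lemma no_Bousfield_colocalization: "\<not> has_Bousfield_colocalization"
proof
  assume has_Bousfield_colocalization
  then obtain G \<phi> where G: "is_functor D K G" and adj: "adjunction D K G Q \<phi>"
    unfolding has_Bousfield_colocalization_def has_left_adjoint_def by blast
  let ?X = "trivial_complex {0}" and ?T = "trivial_complex UNIV"
  have "on_obj G ?X \<in> obj K"
    using G trivial_complex_in_K unfolding is_functor_def D_simps(1) by blast
  then have "set_sized (homs K (on_obj G ?X) ?T)"
    using set_sized_homs_K trivial_complex_in_K by blast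
  moreover have "bij_betw (\<phi> ?X ?T) (homs K (on_obj G ?X) ?T) (homs D ?X ?T)"
    using adjunction_bij[OF adj, of ?X ?T] trivial_complex_in_K by (simp add: D_simps(1))
  ultimately show False using bij_betw_set_sized[OF bij_betw_inv_into] not_set_sized_homs_D by blast
qed

end

theorem corollary1p3:
  fixes elts :: "'u \<Rightarrow> 'u set"
  assumes "universe elts"
  shows "\<not> universe.has_Bousfield_localization elts \<and>
         \<not> universe.has_Bousfield_colocalization elts \<and>
         \<not> has_right_adjoint (universe.A elts) (universe.K elts) inclusion \<and>
         \<not> has_left_adjoint (universe.A elts) (universe.K elts) inclusion"
proof -
  interpret universe elts by fact
  show ?thesis
    using no_Bousfield_localization no_Bousfield_colocalization
      inclusion_no_right_adjoint inclusion_no_left_adjoint by blast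
qed

end
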